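(* Let $N \in B(\mathcal{H})$ be a normal operator with finite spectrum $\sigma(N)$. If $N$ is diagonalizable by a unitary which is a Hilbert--Schmidt perturbation of the identity, then there is a diagonal operator $N'$ with $\sigma(N') \subseteq \sigma(N)$ for which $E(N-N')$ is trace-class, and for any such $N'$, $\operatorname{Tr}\big(E(N-N')\big) \in K_{\sigma(N)}$. In particular, for any such $N'$, $$\operatorname{Tr}\big(E(N-N')\big) = \sum_{\lambda \in \sigma(N)} [P_{\lambda} : Q_{\lambda}]\, \lambda,$$ where $P_\lambda, Q_\lambda$ are the spectral projections onto $\{\lambda\}$ of $N, N'$ respectively (with $Q_\lambda = 0$ if $\lambda \notin \sigma(N')$). Moreover, $P_\lambda - Q_\lambda$ is Hilbert--Schmidt for each $\lambda \in \sigma(N)$.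
   Context: $\mathcal{H}$ is a separable infinite-dimensional complex Hilbert space with a fixed orthonormal basis $\{e_n\}_{n=1}^\infty$. An operator is diagonal if it is diagonal with respect to this fixed basis. "$N$ is diagonalizable by a unitary which is a Hilbert--Schmidt perturbation of the identity" means there is a unitary $U = I + K$ with $K$ Hilbert--Schmidt such that $UNU^*$ is diagonal. $E(T) = \operatorname{diag}(\langle T e_n, e_n\rangle)$ is the canonical trace-preserving conditional expectation of $B(\mathcal{H})$ onto the atomic masa of diagonal operators. For a finite set $X = \{\lambda_1, \ldots, \lambda_m\} \subseteq \mathbb{C}$, $K_X$ denotes the $\mathbb{Z}$-module of all integer linear combinations $\sum_{k} c_k \lambda_k$ ($c_k \in \mathbb{Z}$) with $\sum_k c_k = 0$. For projections $P, Q$ with $P - Q$ compact, the essential codimension of $P$ in $Q$ is the integer $[P:Q] := \operatorname{ind}(QP)$, the Fredholm index of the operator $QP : P\mathcal{H} \to Q\mathcal{H}$; it equals $\operatorname{Tr} P - \operatorname{Tr} Q$ when both traces are finite. *)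

theory Defs
  imports "HOL-Analysis.Analysis"
begin

text \<open>
  Complex Hilbert spaces. The inner product is linear in the first argument; its real part is
  the inner product of the underlying real Hilbert space, so the norm is the library's.
\<close>

class complex_inner = real_inner +
  fixes scaleC :: "complex \<Rightarrow> 'a \<Rightarrow> 'a" (infixr "*\<^sub>C" 75)
    and cinner :: "'a \<Rightarrow> 'a \<Rightarrow> complex"
  assumes scaleC_add_right: "c *\<^sub>C (x + y) = c *\<^sub>C x + c *\<^sub>C y"
    and scaleC_add_left: "(c + d) *\<^sub>C x = c *\<^sub>C x + d *\<^sub>C x"
    and scaleC_scaleC: "c *\<^sub>C d *\<^sub>C x = (c * d) *\<^sub>C x"
    and scaleC_one: "1 *\<^sub>C x = x"
    and scaleR_scaleC: "r *\<^sub>R x = complex_of_real r *\<^sub>C x"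
    and cinner_commute: "cinner x y = cnj (cinner y x)"
    and cinner_add_left: "cinner (x + y) z = cinner x z + cinner y z"
    and cinner_scaleC_left: "cinner (c *\<^sub>C x) y = c * cinner x y"
    and inner_eq_Re_cinner: "inner x y = Re (cinner x y)"

class chilbert_space = complex_inner + complete_space

global_interpretation complex_vector:
  vector_space "scaleC :: complex \<Rightarrow> 'a \<Rightarrow> 'a::complex_inner"
  by unfold_locales
    (simp_all add: scaleC_add_right scaleC_add_left scaleC_scaleC scaleC_one)

text \<open>
  A space with an orthonormal basis indexed by \<open>nat\<close> is separable and infinite-dimensional,
  and every such space has one.
\<close>

definition orthonormal_basis :: "(nat \<Rightarrow> 'a::chilbert_space) \<Rightarrow> bool" where
  "orthonormal_basis e \<longleftrightarrow>
     (\<forall>m n. cinner (e m) (e n) = (if m = n then 1 else 0)) \<and>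
     (\<forall>x. (\<lambda>n. cinner x (e n) *\<^sub>C e n) sums x)"


subsection \<open>Bounded operators\<close>

text \<open>Elements of \<open>B(H)\<close> are functions satisfying the following predicate.\<close>

definition bounded_clinear :: "('a::complex_inner \<Rightarrow> 'a) \<Rightarrow> bool" where
  "bounded_clinear T \<longleftrightarrow> bounded_linear T \<and> (\<forall>c x. T (c *\<^sub>C x) = c *\<^sub>C T x)"

definition cadjoint :: "('a::chilbert_space \<Rightarrow> 'a) \<Rightarrow> 'a \<Rightarrow> 'a" where
  "cadjoint T = (THE S. \<forall>x y. cinner (T x) y = cinner x (S y))"

definition normal_op :: "('a::chilbert_space \<Rightarrow> 'a) \<Rightarrow> bool" where
  "normal_op T \<longleftrightarrow> bounded_clinear T \<and> T \<circ> cadjoint T = cadjoint T \<circ> T"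

definition unitary_op :: "('a::chilbert_space \<Rightarrow> 'a) \<Rightarrow> bool" where
  "unitary_op U \<longleftrightarrow> bounded_clinear U \<and> U \<circ> cadjoint U = id \<and> cadjoint U \<circ> U = id"

definition projection_op :: "('a::chilbert_space \<Rightarrow> 'a) \<Rightarrow> bool" where
  "projection_op P \<longleftrightarrow> bounded_clinear P \<and> P \<circ> P = P \<and> cadjoint P = P"

definition positive_op :: "('a::chilbert_space \<Rightarrow> 'a) \<Rightarrow> bool" where
  "positive_op T \<longleftrightarrow> bounded_clinear T \<and> (\<forall>x. cinner (T x) x \<in> \<real>\<^sub>\<ge>\<^sub>0)"

definition invertible_op :: "('a::chilbert_space \<Rightarrow> 'a) \<Rightarrow> bool" where
  "invertible_op T \<longleftrightarrow> bounded_clinear T \<and>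
     (\<exists>S. bounded_clinear S \<and> S \<circ> T = id \<and> T \<circ> S = id)"

definition spectrum :: "('a::chilbert_space \<Rightarrow> 'a) \<Rightarrow> complex set" where
  "spectrum T = {\<mu>. \<not> invertible_op (\<lambda>x. T x - \<mu> *\<^sub>C x)}"

text \<open>The absolute value is the positive square root of \<open>T\<^sup>*T\<close>.\<close>

definition abs_op :: "('a::chilbert_space \<Rightarrow> 'a) \<Rightarrow> 'a \<Rightarrow> 'a" where
  "abs_op T = (THE S. positive_op S \<and> S \<circ> S = cadjoint T \<circ> T)"


subsection \<open>Hilbert--Schmidt and trace-class operators, trace\<close>

text \<open>
  These are computed in the orthonormal basis \<open>e\<close>; the notions do not depend on its choice.
\<close>

definition hilbert_schmidt :: "(nat \<Rightarrow> 'a::chilbert_space) \<Rightarrow> ('a \<Rightarrow> 'a) \<Rightarrow> bool" where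
  "hilbert_schmidt e T \<longleftrightarrow> bounded_clinear T \<and> summable (\<lambda>n. (norm (T (e n)))\<^sup>2)"

definition trace_class :: "(nat \<Rightarrow> 'a::chilbert_space) \<Rightarrow> ('a \<Rightarrow> 'a) \<Rightarrow> bool" where
  "trace_class e T \<longleftrightarrow> bounded_clinear T \<and> summable (\<lambda>n. Re (cinner (abs_op T (e n)) (e n)))"

definition trace_op :: "(nat \<Rightarrow> 'a::chilbert_space) \<Rightarrow> ('a \<Rightarrow> 'a) \<Rightarrow> complex" where
  "trace_op e T = (\<Sum>n. cinner (T (e n)) (e n))"


subsection \<open>Diagonal operators and the conditional expectation\<close>

definition diagonal_op :: "(nat \<Rightarrow> 'a::chilbert_space) \<Rightarrow> ('a \<Rightarrow> 'a) \<Rightarrow> bool" where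
  "diagonal_op e T \<longleftrightarrow> bounded_clinear T \<and> (\<forall>n. \<exists>d. T (e n) = d *\<^sub>C e n)"

definition diag :: "(nat \<Rightarrow> 'a::chilbert_space) \<Rightarrow> (nat \<Rightarrow> complex) \<Rightarrow> 'a \<Rightarrow> 'a" where
  "diag e d x = (\<Sum>n. (d n * cinner x (e n)) *\<^sub>C e n)"

definition cond_exp :: "(nat \<Rightarrow> 'a::chilbert_space) \<Rightarrow> ('a \<Rightarrow> 'a) \<Rightarrow> 'a \<Rightarrow> 'a" where
  "cond_exp e T = diag e (\<lambda>n. cinner (T (e n)) (e n))"

definition hs_diagonalizable :: "(nat \<Rightarrow> 'a::chilbert_space) \<Rightarrow> ('a \<Rightarrow> 'a) \<Rightarrow> bool" where
  "hs_diagonalizable e N \<longleftrightarrow>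
     (\<exists>U K. unitary_op U \<and> hilbert_schmidt e K \<and> U = (\<lambda>x. x + K x) \<and>
            diagonal_op e (U \<circ> N \<circ> cadjoint U))"


subsection \<open>Spectral projections\<close>

text \<open>
  For a normal operator with finite spectrum the spectral measure is purely atomic, and
  \<open>N = \<integral> z dE(z)\<close> becomes the finite sum below with \<open>P \<mu> = E({\<mu>})\<close>.
  In particular \<open>P \<mu> = 0\<close> off the spectrum. The definition is meant for finite spectrum only.
\<close>

definition spectral_resolution ::
    "('a::chilbert_space \<Rightarrow> 'a) \<Rightarrow> (complex \<Rightarrow> 'a \<Rightarrow> 'a) \<Rightarrow> bool" where
  "spectral_resolution N P \<longleftrightarrow>
     (\<forall>\<mu>. projection_op (P \<mu>)) \<and>
     (\<forall>\<mu> \<nu>. \<mu> \<noteq> \<nu> \<longrightarrow> P \<mu> \<circ> P \<nu> = (\<lambda>x. 0)) \<and>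
     (\<forall>\<mu>. \<mu> \<notin> spectrum N \<longrightarrow> P \<mu> = (\<lambda>x. 0)) \<and>
     (\<forall>x. (\<Sum>\<mu>\<in>spectrum N. P \<mu> x) = x) \<and>
     (\<forall>x. N x = (\<Sum>\<mu>\<in>spectrum N. \<mu> *\<^sub>C P \<mu> x))"

definition spectral_proj :: "('a::chilbert_space \<Rightarrow> 'a) \<Rightarrow> complex \<Rightarrow> 'a \<Rightarrow> 'a" where
  "spectral_proj N = (THE P. spectral_resolution N P)"


subsection \<open>Essential codimension\<close>

text \<open>
  Index of a Fredholm operator \<open>T : V \<rightarrow> W\<close> between closed subspaces, as
  \<open>dim (ker T) - dim ((ran T)\<^sup>\<bottom>)\<close> with the orthogonal complement taken in \<open>W\<close>. The range of a
  Fredholm operator is closed, so this complement is isomorphic to the cokernel. The dimension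
  function of the library is \<open>0\<close> on infinite-dimensional subspaces, so the value is meaningful
  only for Fredholm \<open>T\<close>.
\<close>

definition fredholm_index ::
    "'a::chilbert_space set \<Rightarrow> 'a set \<Rightarrow> ('a \<Rightarrow> 'a) \<Rightarrow> int" where
  "fredholm_index V W T =
     int (complex_vector.dim {x \<in> V. T x = 0}) -
     int (complex_vector.dim {y \<in> W. \<forall>x\<in>V. cinner (T x) y = 0})"

text \<open>Meaningful for projections whose difference is compact, in particular Hilbert--Schmidt.\<close>

definition essential_codim ::
    "('a::chilbert_space \<Rightarrow> 'a) \<Rightarrow> ('a \<Rightarrow> 'a) \<Rightarrow> int" where
  "essential_codim P Q = fredholm_index (range P) (range Q) (Q \<circ> P)"


subsection \<open>The module of integer combinations with vanishing coefficient sum\<close>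

definition K_module :: "complex set \<Rightarrow> complex set" where
  "K_module X = {(\<Sum>\<mu>\<in>X. of_int (c \<mu>) * \<mu>) | c :: complex \<Rightarrow> int. (\<Sum>\<mu>\<in>X. c \<mu>) = 0}"

end

theory Submission
  imports Defs
begin

text \<open>
  Let \<open>U = 1 + K\<close> be the unitary and \<open>D = U N U\<^sup>*\<close>, with entries \<open>d n \<in> \<sigma>(N)\<close>. Unitarity gives
  \<open>2 Re \<langle>K e\<^sub>n, e\<^sub>n\<rangle> = - \<parallel>K e\<^sub>n\<parallel>\<^sup>2\<close>, hence
  \<open>\<langle>N e\<^sub>n, e\<^sub>n\<rangle> - d n = \<langle>D K e\<^sub>n, K e\<^sub>n\<rangle> - d n \<parallel>K e\<^sub>n\<parallel>\<^sup>2\<close>; this is absolutely summable, and since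
  \<open>\<parallel>K e\<^sub>n\<parallel> = \<parallel>K\<^sup>* e\<^sub>n\<parallel>\<close> interchanging a double sum shows that the sum is \<open>0\<close>. If \<open>N' = diag d'\<close> is
  admissible, then \<open>d - d'\<close> is summable with values in a finite set, so it has finite support and the
  trace is the finite sum of \<open>d n - d' n\<close>. With \<open>A = {d = \<mu>}\<close> and \<open>B = {d' = \<mu>}\<close>, the coefficient
  \<open>|A - B| - |B - A|\<close> of \<open>\<mu>\<close> is the essential codimension: for the diagonal projections \<open>R\<close>, \<open>Q\<close>
  onto \<open>A\<close>, \<open>B\<close>, the operator \<open>R U Q + (1 - R) (1 - Q)\<close> is a Hilbert--Schmidt perturbation of the
  identity, so the Fredholm alternative equates the dimensions of its kernel and of that of its adjoint.
\<close>


section \<open>Complex inner products\<close>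

lemma cinner_add_right: "cinner x (y + z) = cinner x y + cinner (x::'a::complex_inner) z"
  by (metis cinner_commute cinner_add_left complex_cnj_add)

lemma cinner_scaleC_right: "cinner x (c *\<^sub>C y) = cnj c * cinner (x::'a::complex_inner) y"
  by (metis cinner_commute cinner_scaleC_left complex_cnj_mult)

lemma cinner_scaleR_left: "cinner (r *\<^sub>R x) y = r *\<^sub>R cinner (x::'a::complex_inner) y"
  by (simp add: scaleR_scaleC cinner_scaleC_left scaleR_conv_of_real)

lemma cinner_scaleR_right: "cinner x (r *\<^sub>R y) = r *\<^sub>R cinner (x::'a::complex_inner) y"
  by (simp add: scaleR_scaleC cinner_scaleC_right scaleR_conv_of_real)

lemma cinner_self: "cinner x x = of_real ((norm (x::'a::complex_inner))\<^sup>2)"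
proof (rule complex_eqI)
  show "Re (cinner x x) = Re (of_real ((norm x)\<^sup>2))"
    by (metis Re_complex_of_real inner_eq_Re_cinner power2_norm_eq_inner)
  have "Im (cinner x x) = - Im (cinner x x)"
    using arg_cong[OF cinner_commute[of x x], of Im] by simp
  then show "Im (cinner x x) = Im (of_real ((norm x)\<^sup>2))" by simp
qed

lemma norm_scaleC: "norm (c *\<^sub>C (x::'a::complex_inner)) = cmod c * norm x"
proof -
  have "complex_of_real ((norm (c *\<^sub>C x))\<^sup>2) = (c * cnj c) * cinner x x"
    unfolding cinner_self[symmetric] by (simp add: cinner_scaleC_left cinner_scaleC_right)
  also have "\<dots> = of_real ((cmod c * norm x)\<^sup>2)"
    by (simp only: cinner_self complex_norm_square[symmetric] power_mult_distrib of_real_mult)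
  finally show ?thesis
    by (simp only: of_real_eq_iff) (auto intro: power2_eq_imp_eq)
qed

lemma cnj_sgn_mult_self: "cnj (sgn z) * z = of_real (cmod z)"
proof (cases "z = 0")
  case False
  have "cnj (sgn z) * z = of_real ((cmod z)\<^sup>2) / of_real (cmod z)"
    by (simp only: sgn_eq complex_cnj_divide complex_cnj_complex_of_real times_divide_eq_left
        mult.commute[of "cnj z"] complex_norm_square)
  then show ?thesis using False by (simp add: power2_eq_square)
qed simp

text \<open>Multiplying \<open>x\<close> by the phase \<open>c\<close> makes the complex inner
  product real and nonnegative, so the real Cauchy-Schwarz inequality applies. When
  \<open>cinner x y = 0\<close> the factor \<open>c\<close> is 0, hence only an inequality in the
  last step.\<close>

lemma cmod_cinner_le: "cmod (cinner x y) \<le> norm x * norm (y::'a::complex_inner)"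
proof -
  define c where "c = cnj (sgn (cinner x y))"
  have "cinner (c *\<^sub>C x) y = of_real (cmod (cinner x y))"
    by (simp add: c_def cinner_scaleC_left cnj_sgn_mult_self)
  then have "cmod (cinner x y) = inner (c *\<^sub>C x) y"
    by (simp add: inner_eq_Re_cinner)
  also have "\<dots> \<le> norm (c *\<^sub>C x) * norm y"
    by (rule norm_cauchy_schwarz)
  also have "\<dots> \<le> norm x * norm y"
    by (simp add: norm_scaleC c_def norm_sgn mult_right_mono)
  finally show ?thesis .
qed

lemma bounded_bilinear_cinner:
  "bounded_bilinear (cinner :: 'a::complex_inner \<Rightarrow> 'a \<Rightarrow> complex)"
  by unfold_locales
    (auto simp: cinner_add_left cinner_add_right cinner_scaleR_left cinner_scaleR_right
      intro!: exI[of _ 1] cmod_cinner_le)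

interpretation cinner: bounded_bilinear "cinner :: 'a::complex_inner \<Rightarrow> 'a \<Rightarrow> complex"
  by (rule bounded_bilinear_cinner)

lemma bounded_bilinear_scaleC:
  "bounded_bilinear (scaleC :: complex \<Rightarrow> 'a::complex_inner \<Rightarrow> 'a)"
  by unfold_locales
    (auto simp: scaleC_add_left scaleC_add_right norm_scaleC scaleR_scaleC scaleC_scaleC
      scaleR_conv_of_real mult_ac intro: exI[of _ 1])

interpretation scaleC: bounded_bilinear "scaleC :: complex \<Rightarrow> 'a::complex_inner \<Rightarrow> 'a"
  by (rule bounded_bilinear_scaleC)

global_interpretation complex_vector_pair: vector_space_pair
  "scaleC :: complex \<Rightarrow> 'a::complex_inner \<Rightarrow> 'a" "scaleC :: complex \<Rightarrow> 'b::complex_inner \<Rightarrow> 'b"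
  by unfold_locales

lemma cinner_eq_0_right: "(\<And>x. cinner x y = 0) \<Longrightarrow> y = (0::'a::complex_inner)"
  using cinner_self[of y] by (simp add: power2_eq_square)

lemma cinner_ext_right: "(\<And>x. cinner x y = cinner x z) \<Longrightarrow> y = (z::'a::complex_inner)"
  using cinner_eq_0_right[of "y - z"] by (simp add: cinner.diff_right)


section \<open>Bounded operators\<close>

lemma bounded_clinearI:
  assumes "\<And>x y. T (x + y) = T x + T y" "\<And>c x. T (c *\<^sub>C x) = c *\<^sub>C T x"
    and "\<And>x. norm (T x) \<le> K * norm x"
  shows "bounded_clinear T"
  unfolding bounded_clinear_def
  using assms by (auto simp: scaleR_scaleC mult.commute intro!: bounded_linear_intro[where K=K])

lemma bounded_clinear_bounded_linear: "bounded_clinear T \<Longrightarrow> bounded_linear T"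
  by (simp add: bounded_clinear_def)

lemma bounded_clinear_scaleC: "bounded_clinear T \<Longrightarrow> T (c *\<^sub>C x) = c *\<^sub>C T x"
  by (simp add: bounded_clinear_def)

lemmas bounded_clinear_add = linear_add[OF bounded_linear.linear, OF bounded_clinear_bounded_linear]
lemmas bounded_clinear_diff = linear_diff[OF bounded_linear.linear, OF bounded_clinear_bounded_linear]
lemmas bounded_clinear_zero = linear_0[OF bounded_linear.linear, OF bounded_clinear_bounded_linear]

lemma bounded_clinear_linear: "bounded_clinear T \<Longrightarrow> Vector_Spaces.linear scaleC scaleC T"
  by (simp add: Vector_Spaces.linear_iff bounded_clinear_add bounded_clinear_scaleC
      complex_vector.vector_space_axioms)

lemma bounded_clinear_compose:
  "bounded_clinear S \<Longrightarrow> bounded_clinear T \<Longrightarrow> bounded_clinear (\<lambda>x. S (T x))"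
  by (auto simp: bounded_clinear_def intro: bounded_linear_compose)

lemma bounded_clinear_plus:
  "bounded_clinear S \<Longrightarrow> bounded_clinear T \<Longrightarrow> bounded_clinear (\<lambda>x. S x + T x)"
  by (auto simp: bounded_clinear_def scaleC_add_right intro: bounded_linear_add)

lemma bounded_clinear_minus:
  "bounded_clinear S \<Longrightarrow> bounded_clinear T \<Longrightarrow> bounded_clinear (\<lambda>x. S x - T x)"
  by (auto simp: bounded_clinear_def scaleC.diff_right intro: bounded_linear_sub)

lemma bounded_clinear_id: "bounded_clinear (\<lambda>x. x)"
  by (auto simp: bounded_clinear_def bounded_linear_ident)

lemma bounded_clinear_const_scaleC: "bounded_clinear (\<lambda>x. c *\<^sub>C x)"
  by (auto simp: bounded_clinear_def scaleC_scaleC mult.commute scaleC.bounded_linear_right)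

section \<open>Adjoints: uniqueness and boundedness\<close>

lemma cadjoint_eqI:
  assumes "\<And>x y. cinner (T x) y = cinner x (S y)"
  shows "cadjoint T = S"
  unfolding cadjoint_def
proof (rule the_equality)
  show "\<forall>x y. cinner (T x) y = cinner x (S y)" using assms by simp
  fix S' assume "\<forall>x y. cinner (T x) y = cinner x (S' y)"
  then show "S' = S" using assms by (intro ext cinner_ext_right) simp
qed

text \<open>Linearity follows from nondegeneracy of the inner product. The bound comes from
  inserting \<open>S y\<close> as the test vector, so that \<open>norm (S y)\<close> squared is at
  most \<open>norm (T (S y)) * norm y\<close>, and cancelling one factor.\<close>

lemma adjoint_bounded_clinear:
  assumes T: "bounded_clinear T" and adj: "\<And>x y. cinner (T x) y = cinner x (S y)"
  shows "bounded_clinear S"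
proof -
  obtain K where K: "\<And>x. norm (T x) \<le> norm x * K" "K > 0"
    using bounded_linear.pos_bounded[OF bounded_clinear_bounded_linear[OF T]] by blast
  show ?thesis
  proof (rule bounded_clinearI)
    fix x y c
    show "S (x + y) = S x + S y"
      by (rule cinner_ext_right) (simp add: cinner_add_right adj[symmetric])
    show "S (c *\<^sub>C x) = c *\<^sub>C S x"
      by (rule cinner_ext_right) (simp add: cinner_scaleC_right adj[symmetric])
  next
    fix y
    have "(norm (S y))\<^sup>2 = cmod (cinner (S y) (S y))"
      by (simp add: cinner_self norm_power)
    also have "\<dots> = cmod (cinner (T (S y)) y)" by (simp add: adj)
    also have "\<dots> \<le> norm (T (S y)) * norm y" by (rule cmod_cinner_le)
    also have "\<dots> \<le> norm (S y) * K * norm y" by (intro mult_right_mono K) simp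
    finally have "norm (S y) * norm (S y) \<le> norm (S y) * (K * norm y)"
      by (simp add: power2_eq_square mult_ac)
    then show "norm (S y) \<le> K * norm y"
      using K(2) by (cases "norm (S y) = 0") (auto simp: mult_le_cancel_left)
  qed
qed

lemma adjoint_swap:
  "(\<And>x y. cinner (T x) y = cinner x (S y)) \<Longrightarrow> cinner (S x) y = cinner x (T y)"
  by (metis cinner_commute)


text \<open>Opens the Cauchy criterion for vector-valued series to Hilbert spaces.\<close>

instance chilbert_space \<subseteq> banach
  by standard


section \<open>Expansion in an orthonormal basis\<close>

locale hilbert_basis =
  fixes e :: "nat \<Rightarrow> 'a::chilbert_space"
  assumes onb: "orthonormal_basis e"
begin

lemma cinner_basis: "cinner (e m) (e n) = (if m = n then 1 else 0)"
  using onb by (simp add: orthonormal_basis_def)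

lemma norm_basis [simp]: "norm (e n) = 1"
proof -
  have "complex_of_real ((norm (e n))\<^sup>2) = of_real 1"
    using cinner_self[of "e n"] by (simp add: cinner_basis)
  then have "(norm (e n))\<^sup>2 = 1" by (simp only: of_real_eq_iff)
  then show ?thesis by (simp add: power2_eq_1_iff) (smt (verit) norm_ge_zero)
qed

lemma basis_sums: "(\<lambda>n. cinner x (e n) *\<^sub>C e n) sums x"
  using onb by (simp add: orthonormal_basis_def)

lemma coeff_ext: "(\<And>n. cinner x (e n) = cinner y (e n)) \<Longrightarrow> x = y"
  using basis_sums[of x] basis_sums[of y] by (simp add: sums_unique2)

lemma parseval: "(\<lambda>n. cinner x (e n) * cnj (cinner y (e n))) sums cinner x y"
  using cinner.bounded_linear_left[THEN bounded_linear.sums, OF basis_sums[of x], of y]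
  by (simp add: cinner_scaleC_left cinner_commute[of "e _" y])

lemma parseval_norm: "(\<lambda>n. (cmod (cinner x (e n)))\<^sup>2) sums (norm x)\<^sup>2"
proof -
  have "(\<lambda>n. complex_of_real ((cmod (cinner x (e n)))\<^sup>2)) sums of_real ((norm x)\<^sup>2)"
    using parseval[of x x] by (simp add: complex_norm_square cinner_self del: of_real_power)
  then show ?thesis by (subst (asm) sums_of_real_iff)
qed

lemma norm_finite_sum:
  assumes "finite A"
  shows "(norm (\<Sum>n\<in>A. a n *\<^sub>C e n))\<^sup>2 = (\<Sum>n\<in>A. (cmod (a n))\<^sup>2)"
proof -
  have "complex_of_real ((norm (\<Sum>n\<in>A. a n *\<^sub>C e n))\<^sup>2) =
      (\<Sum>n\<in>A. \<Sum>m\<in>A. a n * (cnj (a m) * cinner (e n) (e m)))"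
    by (simp add: cinner_self[symmetric] cinner.sum_left cinner.sum_right cinner_scaleC_left
        cinner_scaleC_right sum_distrib_left del: of_real_power) (subst sum.swap, simp add: mult_ac)
  also have "\<dots> = (\<Sum>n\<in>A. \<Sum>m\<in>A. if n = m then a n * cnj (a n) else 0)"
    by (intro sum.cong refl) (auto simp: cinner_basis)
  also have "\<dots> = (\<Sum>n\<in>A. of_real ((cmod (a n))\<^sup>2))"
    using assms by (simp add: complex_norm_square del: of_real_power)
  finally show ?thesis by (simp only: of_real_sum[symmetric] of_real_eq_iff)
qed

text \<open>By Pythagoras the squared norm of a block of the series is the same block of the scalar
  series, so one is Cauchy along with the other.\<close>

lemma riesz_fischer:
  assumes "summable (\<lambda>n. (cmod (a n))\<^sup>2)"
  shows "summable (\<lambda>n. a n *\<^sub>C e n)"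
  unfolding summable_Cauchy
proof (intro allI impI)
  fix \<epsilon> :: real assume "\<epsilon> > 0"
  then have "\<epsilon>\<^sup>2 > 0" by simp
  then obtain N where N: "\<And>m n. m \<ge> N \<Longrightarrow> norm (\<Sum>k\<in>{m..<n}. (cmod (a k))\<^sup>2) < \<epsilon>\<^sup>2"
    using assms unfolding summable_Cauchy by meson
  have "norm (\<Sum>k\<in>{m..<n}. a k *\<^sub>C e k) < \<epsilon>" if "m \<ge> N" for m n
  proof (rule power2_less_imp_less)
    show "(norm (\<Sum>k\<in>{m..<n}. a k *\<^sub>C e k))\<^sup>2 < \<epsilon>\<^sup>2"
      using N[OF that, of n] by (simp add: norm_finite_sum sum_nonneg)
  qed (use \<open>\<epsilon> > 0\<close> in simp)
  then show "\<exists>N. \<forall>m\<ge>N. \<forall>n. norm (\<Sum>k\<in>{m..<n}. a k *\<^sub>C e k) < \<epsilon>" by blast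
qed

lemma cinner_suminf_basis:
  assumes "summable (\<lambda>n. (cmod (a n))\<^sup>2)"
  shows "cinner (\<Sum>n. a n *\<^sub>C e n) (e k) = a k"
proof -
  have "(\<lambda>n. cinner (a n *\<^sub>C e n) (e k)) sums cinner (\<Sum>n. a n *\<^sub>C e n) (e k)"
    by (intro cinner.bounded_linear_left[THEN bounded_linear.sums] summable_sums
        riesz_fischer[OF assms])
  moreover have "cinner (a n *\<^sub>C e n) (e k) = (if n = k then a k else 0)" for n
    by (simp add: cinner_scaleC_left cinner_basis)
  ultimately have "(\<lambda>n. if n = k then a k else 0) sums cinner (\<Sum>n. a n *\<^sub>C e n) (e k)" by simp
  then show ?thesis using sums_single[of k "\<lambda>_. a k"] sums_unique2 by blast
qed

lemma bounded_clinear_sums: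
  "bounded_clinear T \<Longrightarrow> (\<lambda>n. cinner x (e n) *\<^sub>C T (e n)) sums T x"
  using bounded_linear.sums[OF bounded_clinear_bounded_linear basis_sums[of x]]
  by (simp add: bounded_clinear_scaleC)

lemma bounded_clinear_eqI:
  fixes S T :: "'a \<Rightarrow> 'a"
  assumes "bounded_clinear S" "bounded_clinear T" "\<And>n. S (e n) = T (e n)"
  shows "S = T"
proof
  fix x show "S x = T x"
    using bounded_clinear_sums[OF assms(1), of x] bounded_clinear_sums[OF assms(2), of x] assms(3)
    by (simp add: sums_unique2)
qed

text \<open>Justifies the definite description in \<open>cadjoint\<close> by building the adjoint
  from coordinates: the \<open>n\<close>-th coefficient of the image of \<open>y\<close> has to be
  \<open>cinner y (T (e n))\<close>, and Parseval then gives the adjoint identity.\<close>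

lemma cinner_cadjoint:
  fixes T :: "'a \<Rightarrow> 'a"
  assumes T: "bounded_clinear T"
  shows "cinner (T x) y = cinner x (cadjoint T y)"
proof -
  obtain K where K: "\<And>x. norm (T x) \<le> norm x * K" "K > 0"
    using bounded_linear.pos_bounded[OF bounded_clinear_bounded_linear[OF T]] by blast
  define S where "S y = (\<Sum>n. cinner y (T (e n)) *\<^sub>C e n)" for y
  have sm: "summable (\<lambda>n. (cmod (cinner y (T (e n))))\<^sup>2)" for y
  proof (rule bounded_imp_summable)
    fix m
    \<comment> \<open>Testing \<open>T\<close> on the partial sum itself gives
      \<open>cinner y (T s)\<close> equal to the squared norm of \<open>s\<close>. Hence
      \<open>norm s \<le> K * norm y\<close>, uniformly in \<open>m\<close>.\<close>
    define s where "s = (\<Sum>n\<le>m. cinner y (T (e n)) *\<^sub>C e n)"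
    have sn: "(norm s)\<^sup>2 = (\<Sum>n\<le>m. (cmod (cinner y (T (e n))))\<^sup>2)"
      by (simp add: s_def norm_finite_sum)
    have "T s = (\<Sum>n\<le>m. cinner y (T (e n)) *\<^sub>C T (e n))"
      by (simp add: s_def linear_sum[OF bounded_linear.linear[OF bounded_clinear_bounded_linear[OF T]]]
          bounded_clinear_scaleC[OF T])
    then have "cinner y (T s) = of_real ((norm s)\<^sup>2)"
      by (simp add: sn cinner.sum_right cinner_scaleC_right complex_norm_square mult.commute
        del: of_real_power)
    then have "(norm s)\<^sup>2 = cmod (cinner y (T s))" by (simp add: norm_power)
    also have "\<dots> \<le> norm y * (norm s * K)"
      by (rule order_trans[OF cmod_cinner_le]) (intro mult_left_mono K; simp)
    finally have "norm s * norm s \<le> norm s * (K * norm y)"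
      by (simp add: power2_eq_square mult_ac)
    then have "norm s \<le> K * norm y"
      using K(2) by (cases "norm s = 0") (auto simp: mult_le_cancel_left)
    then show "(\<Sum>n\<le>m. (cmod (cinner y (T (e n))))\<^sup>2) \<le> (K * norm y)\<^sup>2"
      unfolding sn[symmetric] by (intro power_mono) auto
  qed simp
  have S: "cinner (T x) y = cinner x (S y)" for x y
  proof -
    have "cinner (S y) (e n) = cinner y (T (e n))" for n
      unfolding S_def by (rule cinner_suminf_basis[OF sm])
    then have "(\<lambda>n. cinner x (e n) * cinner (T (e n)) y) sums cinner x (S y)"
      using parseval[of x "S y"] by (simp add: cinner_commute[of _ y])
    moreover have "(\<lambda>n. cinner x (e n) * cinner (T (e n)) y) sums cinner (T x) y"
      using cinner.bounded_linear_left[THEN bounded_linear.sums, OF bounded_clinear_sums[OF T]]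
      by (simp add: cinner_scaleC_left)
    ultimately show ?thesis by (simp add: sums_unique2)
  qed
  with cadjoint_eqI[of T S] show ?thesis by metis
qed

end

section \<open>Positive square roots, eigenvalues and spectral resolutions\<close>

text \<open>For \<open>b > 0\<close> the defect \<open>y = S x - b x\<close> satisfies
  \<open>S y = - b y\<close>, which positivity allows only for \<open>y = 0\<close>. For
  \<open>b = 0\<close> the vector \<open>w = S x\<close> is killed by \<open>S\<close>, and
  positivity along the line \<open>x + s w\<close> forces \<open>w = 0\<close>.\<close>

lemma positive_op_sqrt_eigenvector:
  assumes S: "positive_op S" and b: "b \<ge> 0" and x: "S (S x) = of_real (b\<^sup>2) *\<^sub>C x"
  shows "S x = of_real b *\<^sub>C x"
proof (cases "b = 0")
  case False
  have lin: "bounded_clinear S" using S by (simp add: positive_op_def)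
  define y where "y = S x - of_real b *\<^sub>C x"
  have "S y = - (of_real b *\<^sub>C y)"
    by (simp add: y_def bounded_clinear_diff[OF lin] bounded_clinear_scaleC[OF lin] x
        scaleC.diff_right scaleC_scaleC power2_eq_square)
  then have "cinner (S y) y = of_real (- (b * (norm y)\<^sup>2))"
    by (simp add: cinner.minus_left cinner_scaleC_left cinner_self)
  moreover have "cinner (S y) y \<in> \<real>\<^sub>\<ge>\<^sub>0" using S by (simp add: positive_op_def)
  ultimately have "b * (norm y)\<^sup>2 \<le> 0" by (simp only: nonneg_Reals_of_real_iff neg_0_le_iff_le)
  then have "y = 0" using b False by (simp add: mult_le_0_iff)
  then show ?thesis by (simp add: y_def)
next
  case True
  have lin: "bounded_clinear S" using S by (simp add: positive_op_def)
  define w where "w = S x"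
  have Sw: "S w = 0" using x True by (simp add: w_def)
  have "w = 0"
  proof (rule ccontr)
    assume "w \<noteq> 0"
    \<comment> \<open>The quadratic form at \<open>x + s w\<close> has real part
      \<open>Re (cinner w x)\<close> plus \<open>s\<close> times the squared norm of
      \<open>w\<close>; this \<open>s\<close> makes it -1.\<close>
    define s where "s = - (Re (cinner w x) + 1) / (norm w)\<^sup>2"
    have "S (x + of_real s *\<^sub>C w) = w"
      by (simp add: bounded_clinear_add[OF lin] bounded_clinear_scaleC[OF lin] Sw w_def[symmetric])
    then have "cinner (S (x + of_real s *\<^sub>C w)) (x + of_real s *\<^sub>C w)
        = cinner w x + of_real (s * (norm w)\<^sup>2)"
      by (simp add: cinner_add_right cinner_scaleC_right cinner_self)
    moreover have "cinner (S (x + of_real s *\<^sub>C w)) (x + of_real s *\<^sub>C w) \<in> \<real>\<^sub>\<ge>\<^sub>0"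
      using S by (simp add: positive_op_def)
    ultimately have "0 \<le> Re (cinner w x) + s * (norm w)\<^sup>2"
      by (simp add: complex_nonneg_Reals_iff del: of_real_mult)
    also have "\<dots> = -1" using \<open>w \<noteq> 0\<close> by (simp add: s_def)
    finally show False by simp
  qed
  then show ?thesis using True by (simp add: w_def)
qed

lemma eigenvalue_in_spectrum:
  assumes "T x = \<mu> *\<^sub>C x" "x \<noteq> 0"
  shows "\<mu> \<in> spectrum T"
proof (rule ccontr)
  assume "\<mu> \<notin> spectrum T"
  then obtain S where S: "bounded_clinear S" "S \<circ> (\<lambda>x. T x - \<mu> *\<^sub>C x) = id"
    by (auto simp: spectrum_def invertible_op_def)
  have "x = S (T x - \<mu> *\<^sub>C x)" using fun_cong[OF S(2), of x] by simp
  also have "\<dots> = 0" by (simp add: assms bounded_clinear_zero[OF S(1)])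
  finally show False using assms by simp
qed

text \<open>Makes the definite description in \<open>spectral_proj\<close> usable. Projections of
  the two families at different points annihilate each other, so inserting either resolution of the
  identity identifies both \<open>Q \<nu>\<close> and \<open>P \<nu>\<close> with
  \<open>Q \<nu> \<circ> P \<nu>\<close>.\<close>

lemma spectral_resolution_unique:
  assumes fin: "finite (spectrum N)" and P: "spectral_resolution N P" and Q: "spectral_resolution N Q"
  shows "P = Q"
proof -
  note defs = P[unfolded spectral_resolution_def] Q[unfolded spectral_resolution_def]
  have proj: "projection_op (P \<mu>)" "projection_op (Q \<mu>)" for \<mu>
    using defs by simp_all
  have orth': "P \<mu> \<circ> P \<nu> = (\<lambda>x. 0)" "Q \<mu> \<circ> Q \<nu> = (\<lambda>x. 0)" if "\<mu> \<noteq> \<nu>" for \<mu> \<nu>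
    using defs that by simp_all
  have zero: "P \<mu> = (\<lambda>x. 0)" "Q \<mu> = (\<lambda>x. 0)" if "\<mu> \<notin> spectrum N" for \<mu>
    using defs that by simp_all
  have one: "(\<Sum>\<mu>\<in>spectrum N. P \<mu> x) = x" "(\<Sum>\<mu>\<in>spectrum N. Q \<mu> x) = x" for x
    using defs by simp_all
  have NP': "N x = (\<Sum>\<mu>\<in>spectrum N. \<mu> *\<^sub>C P \<mu> x)" for x
    using defs(1) by blast
  have NQ': "N x = (\<Sum>\<mu>\<in>spectrum N. \<mu> *\<^sub>C Q \<mu> x)" for x
    using defs(2) by blast
  have lin: "bounded_clinear (P \<mu>)" "bounded_clinear (Q \<mu>)" for \<mu>
    using proj by (simp_all add: projection_op_def)
  have idem: "P \<mu> (P \<mu> x) = P \<mu> x" "Q \<mu> (Q \<mu> x) = Q \<mu> x" for \<mu> x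
    using proj[of \<mu>] by (simp_all add: projection_op_def fun_eq_iff)
  have orth: "P \<mu> (P \<nu> x) = 0" "Q \<mu> (Q \<nu> x) = 0" if "\<mu> \<noteq> \<nu>" for \<mu> \<nu> x
    using orth'[OF that] by (simp_all add: fun_eq_iff)
  have NP: "N (P \<mu> x) = \<mu> *\<^sub>C P \<mu> x" if "\<mu> \<in> spectrum N" for \<mu> x
  proof -
    have "N (P \<mu> x) = (\<Sum>\<nu>\<in>spectrum N. \<nu> *\<^sub>C P \<nu> (P \<mu> x))" by (rule NP')
    also have "\<dots> = (\<Sum>\<nu>\<in>spectrum N. if \<nu> = \<mu> then \<mu> *\<^sub>C P \<mu> x else 0)"
      by (intro sum.cong refl) (auto simp: idem orth)
    finally show ?thesis using fin that by simp
  qed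
  have sum_Q: "Q \<nu> (\<Sum>\<mu>\<in>spectrum N. f \<mu>) = (\<Sum>\<mu>\<in>spectrum N. Q \<nu> (f \<mu>))" for \<nu> f
    by (rule linear_sum[OF bounded_linear.linear[OF bounded_clinear_bounded_linear[OF lin(2)]]])
  have QN: "Q \<nu> (N x) = \<nu> *\<^sub>C Q \<nu> x" if "\<nu> \<in> spectrum N" for \<nu> x
  proof -
    have "Q \<nu> (N x) = (\<Sum>\<mu>\<in>spectrum N. Q \<nu> (\<mu> *\<^sub>C Q \<mu> x))"
      using NQ'[of x] sum_Q[of \<nu> "\<lambda>\<mu>. \<mu> *\<^sub>C Q \<mu> x"] by metis
    also have "\<dots> = (\<Sum>\<mu>\<in>spectrum N. if \<mu> = \<nu> then \<nu> *\<^sub>C Q \<nu> x else 0)"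
      by (intro sum.cong refl) (auto simp: idem orth bounded_clinear_scaleC[OF lin(2)])
    finally show ?thesis using fin that by simp
  qed
  have QP: "Q \<nu> (P \<mu> x) = 0" if "\<mu> \<noteq> \<nu>" "\<mu> \<in> spectrum N" "\<nu> \<in> spectrum N" for \<mu> \<nu> x
  proof -
    \<comment> \<open>Both sides are \<open>Q \<nu> (N (P \<mu> x))\<close>, with \<open>N\<close>
      absorbed to the left or to the right.\<close>
    have "\<nu> *\<^sub>C Q \<nu> (P \<mu> x) = \<mu> *\<^sub>C Q \<nu> (P \<mu> x)"
      using QN[OF that(3), of "P \<mu> x"] NP[OF that(2), of x]
      by (auto simp: bounded_clinear_scaleC[OF lin(2)])
    then show ?thesis using that(1) by (auto simp: complex_vector.scale_cancel_right)
  qed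
  show ?thesis
  proof (intro ext)
    fix \<nu> x
    show "P \<nu> x = Q \<nu> x"
    proof (cases "\<nu> \<in> spectrum N")
      case True
      have "Q \<nu> x = Q \<nu> (\<Sum>\<mu>\<in>spectrum N. P \<mu> x)" by (simp add: one)
      also have "\<dots> = (\<Sum>\<mu>\<in>spectrum N. Q \<nu> (P \<mu> x))" by (rule sum_Q)
      also have "\<dots> = (\<Sum>\<mu>\<in>spectrum N. if \<mu> = \<nu> then Q \<nu> (P \<nu> x) else 0)"
        by (intro sum.cong refl) (use True in \<open>auto simp: QP\<close>)
      also have "\<dots> = (\<Sum>\<kappa>\<in>spectrum N. Q \<kappa> (P \<nu> x))"
        by (intro sum.cong refl) (use True in \<open>auto simp: QP\<close>)
      also have "\<dots> = P \<nu> x" by (rule one)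
      finally show ?thesis by simp
    qed (simp add: zero)
  qed
qed

lemma spectral_proj_eqI:
  "finite (spectrum N) \<Longrightarrow> spectral_resolution N P \<Longrightarrow> spectral_proj N = P"
  unfolding spectral_proj_def by (rule the_equality) (simp_all add: spectral_resolution_unique)


section \<open>Diagonal operators\<close>

lemma bounded_range_indicator [simp]: "bounded (range (indicator A :: nat \<Rightarrow> complex))"
  by (auto intro!: boundedI[of _ 1] simp: indicator_def)

context hilbert_basis
begin

lemma summable_diag:
  assumes "bounded (range d)"
  shows "summable (\<lambda>n. (cmod (d n * cinner x (e n)))\<^sup>2)"
proof -
  obtain M where M: "\<And>n. cmod (d n) \<le> M"
    using assms by (auto simp: bounded_iff)
  show ?thesis
  proof (rule summable_comparison_test')
    show "summable (\<lambda>n. M\<^sup>2 * (cmod (cinner x (e n)))\<^sup>2)"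
      using parseval_norm by (intro summable_mult sums_summable)
    show "norm ((cmod (d n * cinner x (e n)))\<^sup>2) \<le> M\<^sup>2 * (cmod (cinner x (e n)))\<^sup>2" for n
      by (auto simp: norm_mult power_mult_distrib intro!: mult_right_mono power_mono M)
  qed
qed

lemma diag_coeff:
  "bounded (range d) \<Longrightarrow> cinner (diag e d x) (e n) = d n * cinner x (e n)"
  unfolding diag_def by (rule cinner_suminf_basis[OF summable_diag])

lemma norm_diag_le:
  assumes M: "\<And>n. cmod (d n) \<le> M"
  shows "norm (diag e d x) \<le> M * norm x"
proof -
  have M0: "0 \<le> M" using M[of 0] by (meson norm_ge_zero order_trans)
  have b: "bounded (range d)" using M by (auto intro: boundedI)
  have "(norm (diag e d x))\<^sup>2 \<le> M\<^sup>2 * (norm x)\<^sup>2"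
  proof (rule sums_le)
    show "(\<lambda>n. (cmod (cinner (diag e d x) (e n)))\<^sup>2) sums (norm (diag e d x))\<^sup>2"
      by (rule parseval_norm)
    show "(\<lambda>n. M\<^sup>2 * (cmod (cinner x (e n)))\<^sup>2) sums (M\<^sup>2 * (norm x)\<^sup>2)"
      by (intro sums_mult parseval_norm)
    show "(cmod (cinner (diag e d x) (e n)))\<^sup>2 \<le> M\<^sup>2 * (cmod (cinner x (e n)))\<^sup>2" for n
      by (auto simp: diag_coeff[OF b] norm_mult power_mult_distrib
          intro!: mult_right_mono power_mono M)
  qed
  then have "(norm (diag e d x))\<^sup>2 \<le> (M * norm x)\<^sup>2" by (simp add: power_mult_distrib)
  then show ?thesis by (rule power2_le_imp_le) (use M0 in simp)
qed

lemma bounded_clinear_diag: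
  assumes b: "bounded (range d)"
  shows "bounded_clinear (diag e d)"
proof -
  obtain M where M: "\<And>n. cmod (d n) \<le> M" using assms by (auto simp: bounded_iff)
  show ?thesis
    by (rule bounded_clinearI[OF _ _ norm_diag_le[OF M]]; rule coeff_ext)
       (simp_all add: diag_coeff[OF b] cinner_add_left cinner_scaleC_left algebra_simps)
qed

lemma diag_basis: "bounded (range d) \<Longrightarrow> diag e d (e n) = d n *\<^sub>C e n"
  by (rule coeff_ext) (simp add: diag_coeff cinner_scaleC_left cinner_basis)

lemma bounded_diagonal_entries:
  assumes T: "bounded_clinear T"
  shows "bounded (range (\<lambda>n. cinner (T (e n)) (e n)))"
proof -
  obtain K where K: "\<And>x. norm (T x) \<le> norm x * K"
    using bounded_linear.pos_bounded[OF bounded_clinear_bounded_linear[OF T]] by blast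
  have "cmod (cinner (T (e n)) (e n)) \<le> K" for n
    using cmod_cinner_le[of "T (e n)" "e n"] K[of "e n"] by simp
  then show ?thesis by (auto intro: boundedI)
qed

lemma diagonal_op_diag: "bounded (range d) \<Longrightarrow> diagonal_op e (diag e d)"
  by (auto simp: diagonal_op_def bounded_clinear_diag diag_basis)

lemma diagonal_opE:
  assumes "diagonal_op e T"
  obtains d where "bounded (range d)" "T = diag e d"
proof
  have T: "bounded_clinear T" using assms by (simp add: diagonal_op_def)
  show b: "bounded (range (\<lambda>n. cinner (T (e n)) (e n)))" by (rule bounded_diagonal_entries[OF T])
  show "T = diag e (\<lambda>n. cinner (T (e n)) (e n))"
  proof (rule bounded_clinear_eqI[OF T bounded_clinear_diag[OF b]])
    fix n
    obtain d where "T (e n) = d *\<^sub>C e n" using assms by (auto simp: diagonal_op_def)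
    then show "T (e n) = diag e (\<lambda>n. cinner (T (e n)) (e n)) (e n)"
      by (simp add: diag_basis[OF b] cinner_scaleC_left cinner_basis)
  qed
qed

lemma cinner_diag:
  assumes b: "bounded (range d)"
  shows "cinner (diag e d x) y = cinner x (diag e (\<lambda>n. cnj (d n)) y)"
proof -
  have b': "bounded (range (\<lambda>n. cnj (d n)))" using b by (simp add: bounded_iff)
  show ?thesis
    using parseval[of "diag e d x" y] parseval[of x "diag e (\<lambda>n. cnj (d n)) y"]
    by (simp add: diag_coeff[OF b] diag_coeff[OF b'] mult_ac sums_unique2)
qed

lemma cinner_diag_indicator:
  "cinner (diag e (indicator A) x) y = cinner x (diag e (indicator A) y)"
proof -
  have "(\<lambda>n. cnj (indicator A n)) = indicator A" by (auto simp: indicator_def)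
  then show ?thesis using cinner_diag[OF bounded_range_indicator] by simp
qed

lemma diag_indicator_coeff:
  "cinner (diag e (indicator A) x) (e n) = (if n \<in> A then cinner x (e n) else 0)"
  unfolding diag_coeff[OF bounded_range_indicator] by (simp add: indicator_def)

lemma diag_indicator_diag_indicator:
  "diag e (indicator A) (diag e (indicator B) x) = diag e (indicator (A \<inter> B)) x"
  by (rule coeff_ext) (simp add: diag_indicator_coeff)

text \<open>Uniqueness of the positive root is read off the basis: each \<open>e n\<close> is an
  eigenvector of the square, so \<open>positive_op_sqrt_eigenvector\<close> determines the root at
  \<open>e n\<close>.\<close>

lemma abs_op_diag:
  assumes b: "bounded (range t)"
  shows "abs_op (diag e t) = diag e (\<lambda>n. of_real (cmod (t n)))" (is "_ = ?B")
proof -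
  have bB: "bounded (range (\<lambda>n. complex_of_real (cmod (t n))))"
    and bc: "bounded (range (\<lambda>n. cnj (t n)))" using b by (simp_all add: bounded_iff)
  have adj: "cadjoint (diag e t) = diag e (\<lambda>n. cnj (t n))"
    by (rule cadjoint_eqI) (rule cinner_diag[OF b])
  have sq: "cadjoint (diag e t) (diag e t (e n)) = of_real ((cmod (t n))\<^sup>2) *\<^sub>C e n" for n
    by (simp add: adj diag_basis[OF b] bounded_clinear_scaleC[OF bounded_clinear_diag[OF bc]]
        diag_basis[OF bc] scaleC_scaleC complex_norm_square del: of_real_power)
  have linB: "bounded_clinear ?B" by (rule bounded_clinear_diag[OF bB])
  show ?thesis
    unfolding abs_op_def
  proof (rule the_equality)
    have "cinner (?B x) x \<in> \<real>\<^sub>\<ge>\<^sub>0" for x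
    proof -
      have s: "(\<lambda>n. complex_of_real (cmod (t n) * (cmod (cinner x (e n)))\<^sup>2)) sums cinner (?B x) x"
        using parseval[of "?B x" x]
        by (simp add: diag_coeff[OF bB] complex_norm_square mult.assoc del: of_real_power)
      have "Im (cinner (?B x) x) = 0"
        using bounded_linear.sums[OF bounded_linear_Im s] by (simp add: sums_iff)
      moreover have "0 \<le> Re (cinner (?B x) x)"
        by (rule sums_le[OF _ sums_zero bounded_linear.sums[OF bounded_linear_Re s]]) simp
      ultimately show ?thesis by (simp add: complex_nonneg_Reals_iff)
    qed
    then have "positive_op ?B" using linB by (simp add: positive_op_def)
    moreover have "?B \<circ> ?B = cadjoint (diag e t) \<circ> diag e t"
    proof (rule bounded_clinear_eqI)
      show "bounded_clinear (?B \<circ> ?B)" "bounded_clinear (cadjoint (diag e t) \<circ> diag e t)"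
        using bounded_clinear_compose[OF linB linB]
          bounded_clinear_compose[OF bounded_clinear_diag[OF bc] bounded_clinear_diag[OF b]]
        by (simp_all add: comp_def adj)
      show "(?B \<circ> ?B) (e n) = (cadjoint (diag e t) \<circ> diag e t) (e n)" for n
        by (simp add: sq) (simp add: diag_basis[OF bB] bounded_clinear_scaleC[OF linB]
            scaleC_scaleC power2_eq_square)
    qed
    ultimately show "positive_op ?B \<and> ?B \<circ> ?B = cadjoint (diag e t) \<circ> diag e t" by blast
  next
    fix S assume S: "positive_op S \<and> S \<circ> S = cadjoint (diag e t) \<circ> diag e t"
    show "S = ?B"
    proof (rule bounded_clinear_eqI[OF _ linB])
      show "bounded_clinear S" using S by (simp add: positive_op_def)
      fix n
      have "S (S (e n)) = of_real ((cmod (t n))\<^sup>2) *\<^sub>C e n"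
        using fun_cong[OF conjunct2[OF S], of "e n"] sq[of n] by simp
      then have "S (e n) = of_real (cmod (t n)) *\<^sub>C e n"
        by (rule positive_op_sqrt_eigenvector[OF conjunct1[OF S] norm_ge_zero])
      then show "S (e n) = ?B (e n)" by (simp add: diag_basis[OF bB])
    qed
  qed
qed

section \<open>Trace class and trace of the diagonal part, in terms of the diagonal entries\<close>

lemma trace_class_cond_exp_iff:
  assumes T: "bounded_clinear T"
  shows "trace_class e (cond_exp e T) \<longleftrightarrow> summable (\<lambda>n. cmod (cinner (T (e n)) (e n)))"
proof -
  have b: "bounded (range (\<lambda>n. cinner (T (e n)) (e n)))" by (rule bounded_diagonal_entries[OF T])
  then have "bounded (range (\<lambda>n. complex_of_real (cmod (cinner (T (e n)) (e n)))))"
    by (simp add: bounded_iff)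
  then show ?thesis
    by (simp add: trace_class_def cond_exp_def bounded_clinear_diag[OF b] abs_op_diag[OF b]
        diag_coeff cinner_basis)
qed

lemma trace_op_cond_exp:
  assumes T: "bounded_clinear T"
  shows "trace_op e (cond_exp e T) = (\<Sum>n. cinner (T (e n)) (e n))"
  by (simp add: trace_op_def cond_exp_def diag_coeff[OF bounded_diagonal_entries[OF T]] cinner_basis)

text \<open>Here \<open>U'\<close> is the adjoint and inverse of \<open>U\<close>, and
  \<open>N\<close> is the diagonal operator transported by \<open>U\<close>. The vectors
  \<open>U' (e n)\<close> are eigenvectors of \<open>N\<close>. Transporting the projections onto
  the level sets of \<open>d\<close> gives a spectral resolution, and uniqueness identifies
  it.\<close>

lemma
  assumes U: "bounded_clinear U" and adj: "\<And>x y. cinner (U x) y = cinner x (U' y)"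
    and inv: "\<And>x. U (U' x) = x" "\<And>x. U' (U x) = x"
    and d: "bounded (range d)" and N: "\<And>x. N x = U' (diag e d (U x))"
  shows unitary_diag_entries_in_spectrum: "range d \<subseteq> spectrum N"
    and spectral_proj_unitary_diag: "finite (spectrum N) \<Longrightarrow>
      spectral_proj N \<mu> = (\<lambda>x. U' (diag e (indicator (d -` {\<mu>})) (U x)))"
proof -
  have U': "bounded_clinear U'" by (rule adjoint_bounded_clinear[OF U adj])
  note adj' = adjoint_swap[OF adj]
  show sub: "range d \<subseteq> spectrum N"
  proof safe
    fix n
    have "N (U' (e n)) = d n *\<^sub>C U' (e n)"
      by (simp add: N inv diag_basis[OF d] bounded_clinear_scaleC[OF U'])
    moreover have "U' (e n) \<noteq> 0"
      using inv(1)[of "e n"] bounded_clinear_zero[OF U] norm_basis[of n] by force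
    ultimately show "d n \<in> spectrum N" by (rule eigenvalue_in_spectrum)
  qed
  assume fin: "finite (spectrum N)"
  define P where "P \<mu> x = U' (diag e (indicator (d -` {\<mu>})) (U x))" for \<mu> x
  have U'_sum: "U' (\<Sum>\<mu>\<in>A. f \<mu>) = (\<Sum>\<mu>\<in>A. U' (f \<mu>))" for A and f :: "complex \<Rightarrow> _"
    by (rule linear_sum[OF bounded_linear.linear[OF bounded_clinear_bounded_linear[OF U']]])
  have "spectral_resolution N P"
    unfolding spectral_resolution_def
  proof (intro conjI allI impI)
    fix \<mu>
    have "bounded_clinear (P \<mu>)"
      unfolding P_def by (intro bounded_clinear_compose[OF U'] bounded_clinear_compose[OF _ U]
          bounded_clinear_diag) simp
    moreover have "P \<mu> \<circ> P \<mu> = P \<mu>"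
      by (rule ext) (simp add: P_def inv diag_indicator_diag_indicator)
    moreover have "cadjoint (P \<mu>) = P \<mu>"
      by (rule cadjoint_eqI) (simp add: P_def adj adj' cinner_diag_indicator)
    ultimately show "projection_op (P \<mu>)" by (simp add: projection_op_def)
  next
    fix \<mu> \<nu> :: complex assume "\<mu> \<noteq> \<nu>"
    then have "d -` {\<mu>} \<inter> d -` {\<nu>} = {}" by auto
    then have "diag e (indicator (d -` {\<mu>})) (diag e (indicator (d -` {\<nu>})) x) = 0" for x
      by (simp add: diag_indicator_diag_indicator) (simp add: diag_def)
    then show "P \<mu> \<circ> P \<nu> = (\<lambda>x. 0)"
      by (simp add: P_def fun_eq_iff inv bounded_clinear_zero[OF U'])
  next
    fix \<mu> assume "\<mu> \<notin> spectrum N"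
    then have "d -` {\<mu>} = {}" using sub by auto
    then have "P \<mu> x = 0" for x
      by (simp add: P_def) (simp add: diag_def bounded_clinear_zero[OF U'])
    then show "P \<mu> = (\<lambda>x. 0)" by auto
  next
    fix x
    \<comment> \<open>In coordinate \<open>n\<close> of each sum below only the term
      \<open>\<mu> = d n\<close> survives; this fact guarantees that it occurs.\<close>
    have dn: "d n \<in> spectrum N" for n using sub by auto
    have "(\<Sum>\<mu>\<in>spectrum N. diag e (indicator (d -` {\<mu>})) y) = y" for y
      by (rule coeff_ext) (simp add: cinner.sum_left diag_indicator_coeff fin dn)
    then show "(\<Sum>\<mu>\<in>spectrum N. P \<mu> x) = x"
      by (simp add: P_def U'_sum[symmetric] inv)
    have "(\<Sum>\<mu>\<in>spectrum N. \<mu> *\<^sub>C diag e (indicator (d -` {\<mu>})) y) = diag e d y" for y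
      by (rule coeff_ext) (simp add: cinner.sum_left cinner_scaleC_left diag_indicator_coeff fin dn
          diag_coeff[OF d] if_distrib[of "(*) _"] cong: if_cong)
    then show "N x = (\<Sum>\<mu>\<in>spectrum N. \<mu> *\<^sub>C P \<mu> x)"
      by (simp add: P_def N U'_sum[symmetric] bounded_clinear_scaleC[OF U', symmetric])
  qed
  then show "spectral_proj N \<mu> = (\<lambda>x. U' (diag e (indicator (d -` {\<mu>})) (U x)))"
    using spectral_proj_eqI[OF fin] by (auto simp: P_def)
qed

end

section \<open>Dimensions of subspaces\<close>

lemma independent_Un:
  assumes A: "complex_vector.independent A" and B: "complex_vector.independent B"
    and AB: "complex_vector.span A \<inter> complex_vector.span B \<subseteq> {0}"
  shows "complex_vector.independent (A \<union> B)" "A \<inter> B = {}"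
proof -
  have "0 \<notin> A" using A complex_vector.dependent_zero by blast
  then show disj: "A \<inter> B = {}" using AB complex_vector.span_base by blast
  show "complex_vector.independent (A \<union> B)"
    unfolding complex_vector.independent_explicit_module
  proof (intro allI impI)
    fix t u v assume t: "finite t" "t \<subseteq> A \<union> B" "(\<Sum>v\<in>t. u v *\<^sub>C v) = 0" "v \<in> t"
    let ?a = "\<Sum>v\<in>t \<inter> A. u v *\<^sub>C v" and ?b = "\<Sum>v\<in>t - A. u v *\<^sub>C v"
    have s: "?a + ?b = 0"
      using t(1,3) sum.Int_Diff[of t "\<lambda>v. u v *\<^sub>C v" A] by simp
    have "?a \<in> complex_vector.span A"
      by (intro complex_vector.span_sum complex_vector.span_scale complex_vector.span_base) auto
    moreover have "?b \<in> complex_vector.span B"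
      by (intro complex_vector.span_sum complex_vector.span_scale complex_vector.span_base)
        (use t in auto)
    moreover have "?a = - ?b" using s by (simp add: eq_neg_iff_add_eq_0)
    ultimately have "?a \<in> complex_vector.span A \<inter> complex_vector.span B"
      by (simp add: complex_vector.span_neg)
    then have a0: "?a = 0" using AB by blast
    then have b0: "?b = 0" using s by simp
    show "u v = 0"
    proof (cases "v \<in> A")
      case True
      then show ?thesis
        using complex_vector.independentD[OF A _ _ a0, of v] t by auto
    next
      case False
      then show ?thesis
        using complex_vector.independentD[OF B _ _ b0, of v] t by auto
    qed
  qed
qed

lemma span_Int_independent:
  assumes fin: "finite A" "finite B" and ind: "complex_vector.independent (A \<union> B)"
    and disj: "A \<inter> B = {}"
  shows "complex_vector.span A \<inter> complex_vector.span B \<subseteq> {0}"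
proof
  fix x assume "x \<in> complex_vector.span A \<inter> complex_vector.span B"
  then have "x \<in> range (\<lambda>u. \<Sum>v\<in>A. u v *\<^sub>C v)" "x \<in> range (\<lambda>u. \<Sum>v\<in>B. u v *\<^sub>C v)"
    by (simp_all add: complex_vector.span_finite fin)
  then obtain u w where u: "x = (\<Sum>v\<in>A. u v *\<^sub>C v)" and w: "x = (\<Sum>v\<in>B. w v *\<^sub>C v)"
    by blast
  \<comment> \<open>Subtracting the two expansions of \<open>x\<close> gives one linear relation
    over \<open>A \<union> B\<close>; disjointness keeps the two sets of coefficients apart.\<close>
  let ?c = "\<lambda>v. if v \<in> A then u v else - w v"
  have "(\<Sum>v\<in>A \<union> B. ?c v *\<^sub>C v) = (\<Sum>v\<in>A. ?c v *\<^sub>C v) + (\<Sum>v\<in>B. ?c v *\<^sub>C v)"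
    by (rule sum.union_disjoint[OF fin disj])
  also have "(\<Sum>v\<in>B. ?c v *\<^sub>C v) = (\<Sum>v\<in>B. - (w v *\<^sub>C v))"
    by (intro sum.cong refl) (use disj in \<open>auto simp: scaleC.minus_left\<close>)
  also have "(\<Sum>v\<in>A. ?c v *\<^sub>C v) = x" unfolding u by (intro sum.cong) auto
  finally have sum_c: "(\<Sum>v\<in>A \<union> B. ?c v *\<^sub>C v) = 0" using w by (simp add: sum_negf)
  have c: "?c v = 0" if "v \<in> A" for v
    using complex_vector.independentD[OF ind _ subset_refl, of ?c v] sum_c that fin by blast
  have "u v = 0" if "v \<in> A" for v using c[OF that] that by simp
  then show "x \<in> {0}" by (simp add: u)
qed

lemma linear_inj_onI:
  assumes f: "Vector_Spaces.linear scaleC scaleC f" and S: "complex_vector.subspace S"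
    and ker: "\<And>x. x \<in> S \<Longrightarrow> f x = 0 \<Longrightarrow> x = 0"
  shows "inj_on f S"
proof (rule inj_onI)
  fix x y assume "x \<in> S" "y \<in> S" "f x = f y"
  then have "x - y = 0"
    by (intro ker complex_vector.subspace_diff[OF S]) (auto simp: complex_vector_pair.linear_diff[OF f])
  then show "x = y" by simp
qed

lemma dim_injective_image:
  assumes f: "Vector_Spaces.linear scaleC scaleC f" and inj: "inj_on f V"
    and V: "complex_vector.subspace V"
  shows "complex_vector.dim (f ` V) = complex_vector.dim V"
proof -
  obtain B where B: "B \<subseteq> V" "complex_vector.independent B" "V \<subseteq> complex_vector.span B"
    "card B = complex_vector.dim V"
    using complex_vector.basis_exists by blast
  have sp: "complex_vector.span B = V" using B V by (metis complex_vector.span_subspace)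
  show ?thesis
  proof (rule complex_vector.dim_unique)
    show "f ` B \<subseteq> f ` V" using B by blast
    show "f ` V \<subseteq> complex_vector.span (f ` B)"
      by (simp add: complex_vector_pair.linear_span_image[OF f] sp)
    show "complex_vector.independent (f ` B)"
      by (rule complex_vector_pair.linear_independent_injective_image[OF f B(2)]) (simp add: sp inj)
    show "card (f ` B) = complex_vector.dim V"
      using B inj by (metis card_image inj_on_subset)
  qed
qed

text \<open>The union of bases of the summands is a basis of the sum. The finite spanning set
  matters because \<open>dim\<close> is 0 on infinite-dimensional spaces, where additivity can
  fail.\<close>

lemma dim_direct_sum:
  assumes V: "complex_vector.subspace V" and W: "complex_vector.subspace W"
    and VW: "V \<inter> W \<subseteq> {0}"
    and fin: "finite A" "{v + w | v w. v \<in> V \<and> w \<in> W} \<subseteq> complex_vector.span A"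
  shows "complex_vector.dim {v + w | v w. v \<in> V \<and> w \<in> W} =
    complex_vector.dim V + complex_vector.dim W"
proof -
  obtain B where B: "B \<subseteq> V" "complex_vector.independent B" "V \<subseteq> complex_vector.span B"
    "card B = complex_vector.dim V"
    using complex_vector.basis_exists by blast
  obtain C where C: "C \<subseteq> W" "complex_vector.independent C" "W \<subseteq> complex_vector.span C"
    "card C = complex_vector.dim W"
    using complex_vector.basis_exists by blast
  have sp: "complex_vector.span B = V" "complex_vector.span C = W"
    using B C V W by (metis complex_vector.span_subspace)+
  have 0: "0 \<in> V" "0 \<in> W" using V W by (auto simp: complex_vector.subspace_0)
  have "v \<in> {v + w | v w. v \<in> V \<and> w \<in> W}" if "v \<in> V" for v
    using that 0 by (intro CollectI exI[of _ v] exI[of _ 0]) auto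
  moreover have "w \<in> {v + w | v w. v \<in> V \<and> w \<in> W}" if "w \<in> W" for w
    using that 0 by (intro CollectI exI[of _ 0] exI[of _ w]) auto
  ultimately have sub: "B \<union> C \<subseteq> {v + w | v w. v \<in> V \<and> w \<in> W}" using B(1) C(1) by blast
  have ind: "complex_vector.independent (B \<union> C)" "B \<inter> C = {}"
    using independent_Un[OF B(2) C(2)] VW sp by auto
  have "finite (B \<union> C)"
    using complex_vector.independent_span_bound[OF fin(1) ind(1)] sub fin(2) by blast
  then have "card (B \<union> C) = card B + card C" using ind by (simp add: card_Un_disjoint)
  then show ?thesis
    using sub ind B(4) C(4)
    by (intro complex_vector.dim_unique[of "B \<union> C"]) (auto simp: complex_vector.span_Un sp)
qed


section \<open>The Fredholm alternative for Hilbert--Schmidt perturbations of the identity\<close>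

context hilbert_basis
begin

text \<open>The operator norm is at most the Hilbert-Schmidt norm: Cauchy-Schwarz for the partial
  sums of the expansion of \<open>T x\<close>, then a passage to the limit.\<close>

lemma hilbert_schmidt_norm_le:
  assumes T: "bounded_clinear T" and s: "(\<lambda>n. (norm (T (e n)))\<^sup>2) sums s"
  shows "norm (T x) \<le> sqrt s * norm x"
proof (rule LIMSEQ_le_const2)
  show "(\<lambda>k. norm (\<Sum>n<k. cinner x (e n) *\<^sub>C T (e n))) \<longlonglongrightarrow> norm (T x)"
    using bounded_clinear_sums[OF T] by (intro tendsto_norm) (simp add: sums_def)
  have "norm (\<Sum>n<k. cinner x (e n) *\<^sub>C T (e n)) \<le> sqrt s * norm x" for k
  proof -
    have "norm (\<Sum>n<k. cinner x (e n) *\<^sub>C T (e n)) \<le>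
        (\<Sum>n<k. \<bar>norm (T (e n))\<bar> * \<bar>cmod (cinner x (e n))\<bar>)"
      by (rule order_trans[OF norm_sum]) (simp add: norm_scaleC mult.commute)
    also have "\<dots> \<le> L2_set (\<lambda>n. norm (T (e n))) {..<k} * L2_set (\<lambda>n. cmod (cinner x (e n))) {..<k}"
      by (rule L2_set_mult_ineq)
    also have "\<dots> \<le> sqrt s * norm x"
    proof (intro mult_mono)
      show "L2_set (\<lambda>n. norm (T (e n))) {..<k} \<le> sqrt s"
        unfolding L2_set_def using sum_le_suminf[of "\<lambda>n. (norm (T (e n)))\<^sup>2" "{..<k}"] s
        by (simp add: sums_iff)
      have "(\<Sum>n<k. (cmod (cinner x (e n)))\<^sup>2) \<le> (norm x)\<^sup>2"
        using sum_le_suminf[of "\<lambda>n. (cmod (cinner x (e n)))\<^sup>2" "{..<k}"] parseval_norm[of x]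
        by (simp add: sums_iff)
      then show "L2_set (\<lambda>n. cmod (cinner x (e n))) {..<k} \<le> norm x"
        unfolding L2_set_def by (intro real_le_lsqrt) (auto simp: sum_nonneg)
      have "0 \<le> s" by (rule sums_le[OF _ sums_zero s]) simp
      then show "0 \<le> sqrt s" by simp
    qed (simp add: L2_set_nonneg)
    finally show ?thesis .
  qed
  then show "\<exists>N. \<forall>k\<ge>N. norm (\<Sum>n<k. cinner x (e n) *\<^sub>C T (e n)) \<le> sqrt s * norm x" by blast
qed

text \<open>
  \<open>E\<close> cuts off so many basis vectors that \<open>L \<circ> (1 - E)\<close> becomes a contraction;
  then \<open>V = 1 + L \<circ> (1 - E)\<close> is invertible.
\<close>

lemma hilbert_schmidt_decomposition:
  assumes L: "hilbert_schmidt e L"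
  obtains E V A where "bounded_clinear E" "\<And>x. E (E x) = E x"
    "\<And>x. E x \<in> complex_vector.span A" "finite A"
    "bounded_clinear V" "bij V" "\<And>x. E x = 0 \<Longrightarrow> V x = x + L x"
proof -
  have Llin: "bounded_clinear L" and sm: "summable (\<lambda>n. (norm (L (e n)))\<^sup>2)"
    using L by (simp_all add: hilbert_schmidt_def)
  \<comment> \<open>The tail bound 1 makes the Hilbert-Schmidt norm \<open>q\<close> of
    \<open>F = L \<circ> (1 - E)\<close> smaller than 1.\<close>
  obtain m where m: "norm (\<Sum>i. (norm (L (e (i + m))))\<^sup>2) < 1"
    using suminf_exist_split[OF zero_less_one sm] by blast
  define E where "E = diag e (indicator {..<m})"
  have E: "bounded_clinear E" unfolding E_def by (rule bounded_clinear_diag) simp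
  have EE: "E (E x) = E x" for x by (simp add: E_def diag_indicator_diag_indicator)
  have Ee: "E (e n) = (if n < m then e n else 0)" for n
    unfolding E_def diag_basis[OF bounded_range_indicator] by (simp add: indicator_def)
  have "E x = (\<Sum>n<m. cinner x (e n) *\<^sub>C e n)" for x
    by (rule coeff_ext) (simp add: E_def diag_indicator_coeff cinner.sum_left cinner_scaleC_left
        cinner_basis if_distrib[of "(*) _"] cong: if_cong)
  then have Esp: "E x \<in> complex_vector.span (e ` {..<m})" for x
    by (simp only:) (intro complex_vector.span_sum complex_vector.span_scale
        complex_vector.span_base imageI)
  define F where "F x = L (x - E x)" for x
  have F: "bounded_clinear F"
    unfolding F_def by (intro bounded_clinear_compose[OF Llin] bounded_clinear_minus bounded_clinear_id E)
  define s where "s = (\<Sum>i. (norm (L (e (i + m))))\<^sup>2)"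
  have Fe: "F (e n) = (if n < m then 0 else L (e n))" for n
    by (simp add: F_def Ee bounded_clinear_zero[OF Llin])
  have "(\<lambda>n. (norm (F (e (n + m))))\<^sup>2) sums s"
    using summable_sums[OF summable_ignore_initial_segment[OF sm, of m]] by (simp add: s_def Fe)
  then have sF: "(\<lambda>n. (norm (F (e n)))\<^sup>2) sums s"
    by (subst (asm) sums_zero_iff_shift) (auto simp: Fe)
  have "0 \<le> s" by (rule sums_le[OF _ sums_zero sF]) simp
  moreover have "s < 1" using m by (simp add: s_def)
  ultimately obtain q where q: "0 \<le> q" "q < 1" "q = sqrt s"
    by simp
  have Fq: "norm (F x) \<le> q * norm x" for x
    unfolding q(3) by (rule hilbert_schmidt_norm_le[OF F sF])
  define V where "V x = x + F x" for x
  have V: "bounded_clinear V"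
    unfolding V_def by (rule bounded_clinear_plus[OF bounded_clinear_id F])
  have "inj_on V UNIV"
  proof (rule linear_inj_onI[OF bounded_clinear_linear[OF V] complex_vector.subspace_UNIV])
    fix x assume "V x = 0"
    then have "x = - F x" by (simp add: V_def eq_neg_iff_add_eq_0)
    then have "norm x \<le> q * norm x" using Fq[of x] by (metis norm_minus_cancel)
    then have "(1 - q) * norm x \<le> 0" by (simp add: algebra_simps)
    then show "x = 0" using q by (simp add: mult_le_0_iff)
  qed
  moreover have "\<exists>x. y = V x" for y
  proof -
    \<comment> \<open>Solving \<open>x + F x = y\<close> is finding a fixed point of the contraction
      that sends \<open>x\<close> to \<open>y - F x\<close>.\<close>
    have contr: "dist (y - F x) (y - F x') \<le> q * dist x x'" for x x'
      using Fq[of "x' - x"] by (simp add: dist_norm bounded_clinear_diff[OF F] norm_minus_commute)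
    have "\<exists>!x. y - F x = x"
      by (rule banach_fix_type[OF q(1,2)]) (intro allI contr)
    then obtain x where "y - F x = x" by blast
    then show ?thesis by (intro exI[of _ x]) (simp add: V_def algebra_simps)
  qed
  ultimately have "bij V" by (simp add: bij_def surj_def)
  show ?thesis
  proof (rule that[OF E EE Esp _ V \<open>bij V\<close>])
    show "V x = x + L x" if "E x = 0" for x using that by (simp add: V_def F_def)
  qed simp
qed

text \<open>Everything is counted inside the finite-dimensional range of \<open>E\<close>. Since
  \<open>G = 1 + L\<close> agrees with the bijection \<open>V\<close> on the kernel of
  \<open>E\<close>, the map \<open>E\<close> embeds the kernel \<open>K\<close> of \<open>G\<close>
  into that range. Let \<open>C1\<close> span a complement of the image. Then \<open>G\<close> is
  injective on the span of \<open>C1\<close>, the space \<open>K'\<close> is orthogonal to the range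
  of \<open>G\<close>, and \<open>E\<close> composed with the inverse of \<open>V\<close> embeds the
  sum of \<open>G (span C1)\<close> and \<open>K'\<close> into the range of \<open>E\<close>.
  Comparing dimensions and cancelling \<open>card C1\<close> gives the inequality.\<close>

lemma fredholm_alternative_le:
  assumes L: "hilbert_schmidt e L" and adj: "\<And>x y. cinner (L x) y = cinner x (L' y)"
  shows "\<exists>A. finite A \<and> {x. x + L x = 0} \<subseteq> complex_vector.span A" (is ?fin)
    and "complex_vector.dim {x. x + L' x = 0} \<le> complex_vector.dim {x. x + L x = 0}" (is ?le)
proof -
  have Llin: "bounded_clinear L" using L by (simp add: hilbert_schmidt_def)
  obtain E V A where E: "bounded_clinear E" and EE: "\<And>x. E (E x) = E x"
    and A: "\<And>x. E x \<in> complex_vector.span A" "finite A"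
    and V: "bounded_clinear V" and bij: "bij V"
    and V0: "\<And>x. E x = 0 \<Longrightarrow> V x = x + L x"
    by (rule hilbert_schmidt_decomposition[OF L]) (rule that)
  define G where "G x = x + L x" for x
  have G: "bounded_clinear G"
    unfolding G_def by (rule bounded_clinear_plus[OF bounded_clinear_id Llin])
  note linE = bounded_clinear_linear[OF E] and linG = bounded_clinear_linear[OF G]
    and linV = bounded_clinear_linear[OF V]
  define K where "K = {x. x + L x = 0}"
  define K' where "K' = {x. x + L' x = 0}"
  have K_eq: "K = {x. G x = 0}" by (simp add: K_def G_def)
  have subK: "complex_vector.subspace K"
    unfolding K_eq by (rule complex_vector_pair.linear_subspace_kernel[OF linG])
  have L'lin: "bounded_clinear L'" by (rule adjoint_bounded_clinear[OF Llin adj])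
  have subK': "complex_vector.subspace K'"
    unfolding K'_def by (rule complex_vector_pair.linear_subspace_kernel[OF
          bounded_clinear_linear[OF bounded_clinear_plus[OF bounded_clinear_id L'lin]]])
  have orth: "cinner (G x) y = 0" if "y \<in> K'" for x y
  proof -
    have "cinner (G x) y = cinner x (y + L' y)" by (simp add: G_def cinner_add_left cinner_add_right adj)
    also have "y + L' y = 0" using that by (simp add: K'_def)
    finally show ?thesis by (simp only: cinner.zero_right)
  qed
  have V_inj: "x = 0" if "V x = 0" for x
    using injD[OF bij_is_inj[OF bij], of x 0] that by (simp add: bounded_clinear_zero[OF V])
  have EK: "x = 0" if "x \<in> K" "E x = 0" for x
    using that V0[of x] V_inj[of x] by (simp add: K_def)
  have injEK: "inj_on E K" by (rule linear_inj_onI[OF linE subK EK])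
  obtain B where B: "B \<subseteq> K" "complex_vector.independent B" "K \<subseteq> complex_vector.span B"
    "card B = complex_vector.dim K"
    using complex_vector.basis_exists by blast
  have spB: "complex_vector.span B = K" using B subK by (metis complex_vector.span_subspace)
  have indEB: "complex_vector.independent (E ` B)"
    by (rule complex_vector_pair.linear_independent_injective_image[OF linE B(2)])
      (simp add: spB injEK)
  \<comment> \<open>\<open>C\<close> is a basis of the range of \<open>E\<close> extending the image
    of a basis of the kernel of \<open>G\<close>; the added vectors form \<open>C1\<close>.\<close>
  obtain C where C: "E ` B \<subseteq> C" "C \<subseteq> range E" "complex_vector.independent C"
    "range E \<subseteq> complex_vector.span C"
    using complex_vector.maximal_independent_subset_extend[OF _ indEB, of "range E"] by blast
  have finC: "finite C"
    using complex_vector.independent_span_bound[OF A(2) C(3)] C(2) A(1) by blast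
  have finEB: "finite (E ` B)" by (rule finite_subset[OF C(1) finC])
  have injEB: "inj_on E B" by (rule inj_on_subset[OF injEK B(1)])
  have finB: "finite B" using finEB finite_image_iff[OF injEB] by simp
  show ?fin using finB B(3) unfolding K_def by blast
  define C1 where "C1 = C - E ` B"
  have C_eq: "C = C1 \<union> E ` B" and disjC: "C1 \<inter> E ` B = {}" using C(1) by (auto simp: C1_def)
  have finC1: "finite C1" using finC by (simp add: C1_def)
  have indC1: "complex_vector.independent C1"
    using complex_vector.independent_mono[OF C(3)] by (simp add: C1_def)
  have ErangeE: "E x = x" if "x \<in> range E" for x
    using that EE by (metis imageE)
  have "complex_vector.subspace (range E)"
    by (rule complex_vector_pair.linear_subspace_image[OF linE complex_vector.subspace_UNIV])
  then have spC1: "complex_vector.span C1 \<subseteq> range E"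
    using C(2) by (intro complex_vector.span_minimal) (auto simp: C1_def)
  have key: "c = 0" if c: "c \<in> complex_vector.span C1" and z: "E z = 0" and eq: "G c = G z" for c z
  proof -
    have "c - z \<in> K" by (simp add: K_eq eq bounded_clinear_diff[OF G])
    then have "E (c - z) \<in> complex_vector.span (E ` B)"
      by (simp add: complex_vector_pair.linear_span_image[OF linE] spB)
    moreover have "E (c - z) = c"
      using ErangeE[of c] c spC1 by (simp add: bounded_clinear_diff[OF E] z subset_iff)
    moreover have "complex_vector.span C1 \<inter> complex_vector.span (E ` B) \<subseteq> {0}"
      by (rule span_Int_independent[OF finC1 finEB _ disjC]) (simp add: C_eq[symmetric] C(3))
    ultimately show ?thesis using c by auto
  qed
  have injGC1: "inj_on G (complex_vector.span C1)"
    by (rule linear_inj_onI[OF linG complex_vector.subspace_span])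
      (use key[of _ 0] in \<open>simp add: bounded_clinear_zero[OF E] bounded_clinear_zero[OF G]\<close>)
  have indGC1: "complex_vector.independent (G ` C1)"
    by (rule complex_vector_pair.linear_independent_injective_image[OF linG indC1 injGC1])
  obtain B' where B': "B' \<subseteq> K'" "complex_vector.independent B'" "K' \<subseteq> complex_vector.span B'"
    "card B' = complex_vector.dim K'"
    using complex_vector.basis_exists by blast
  have spB': "complex_vector.span B' = K'" using B' subK' by (metis complex_vector.span_subspace)
  have spGC1: "complex_vector.span (G ` C1) = G ` complex_vector.span C1"
    by (rule complex_vector_pair.linear_span_image[OF linG])
  \<comment> \<open>Such a vector is orthogonal to itself.\<close>
  have G_K': "G x = 0" if "G x \<in> K'" for x
    using orth[OF that, of x] by (simp add: cinner_self)
  have cap: "complex_vector.span (G ` C1) \<inter> complex_vector.span B' \<subseteq> {0}"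
    unfolding spGC1 spB' using G_K' by blast
  have ind: "complex_vector.independent (G ` C1 \<union> B')" "G ` C1 \<inter> B' = {}"
    using independent_Un[OF indGC1 B'(2) cap] by blast+
  obtain W where linW: "Vector_Spaces.linear scaleC scaleC W" and WV: "W \<circ> V = id"
    using complex_vector_pair.linear_injective_left_inverse[OF linV bij_is_inj[OF bij]] by blast
  have VW: "V (W x) = x" for x
  proof -
    obtain y where "x = V y" using surjD[OF bij_is_surj[OF bij]] by blast
    then show ?thesis using fun_cong[OF WV, of y] by simp
  qed
  \<comment> \<open>As \<open>W\<close> inverts \<open>V\<close>, the kernel of \<open>\<pi>\<close>
    is the \<open>V\<close>-image, hence the \<open>G\<close>-image, of the kernel of
    \<open>E\<close>. Injectivity of \<open>\<pi>\<close> below therefore reduces to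
    \<open>key\<close>.\<close>
  define \<pi> where "\<pi> x = E (W x)" for x
  have lin\<pi>: "Vector_Spaces.linear scaleC scaleC \<pi>"
    using Vector_Spaces.linear_compose[OF linW linE] by (simp add: \<pi>_def[abs_def] comp_def)
  have inj\<pi>: "inj_on \<pi> (complex_vector.span (G ` C1 \<union> B'))"
  proof (rule linear_inj_onI[OF lin\<pi> complex_vector.subspace_span])
    fix x assume "x \<in> complex_vector.span (G ` C1 \<union> B')" and \<pi>x: "\<pi> x = 0"
    then obtain c b where c: "c \<in> complex_vector.span C1" and b: "b \<in> K'" and x: "x = G c + b"
      by (auto simp: complex_vector.span_Un spGC1 spB')
    define z where "z = W x"
    have z: "E z = 0" using \<pi>x by (simp add: \<pi>_def z_def)
    have "x = V z" by (simp add: z_def VW)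
    also have "\<dots> = G z" using V0[OF z] by (simp add: G_def)
    finally have xz: "x = G z" .
    have b': "b = G (z - c)" using x xz by (simp add: bounded_clinear_diff[OF G])
    have "b = 0" using b G_K'[of "z - c"] unfolding b' by blast
    then have "c = 0" using key[OF c z] x xz by simp
    then show "x = 0" using x \<open>b = 0\<close> by (simp add: bounded_clinear_zero[OF G])
  qed
  have ind\<pi>: "complex_vector.independent (\<pi> ` (G ` C1 \<union> B'))"
    by (rule complex_vector_pair.linear_independent_injective_image[OF lin\<pi> ind(1) inj\<pi>])
  have "\<pi> ` (G ` C1 \<union> B') \<subseteq> complex_vector.span C" using C(4) by (auto simp: \<pi>_def)
  then have le: "finite (\<pi> ` (G ` C1 \<union> B'))" "card (\<pi> ` (G ` C1 \<union> B')) \<le> card C"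
    using complex_vector.independent_span_bound[OF finC ind\<pi>] by auto
  have inj\<pi>': "inj_on \<pi> (G ` C1 \<union> B')"
    by (rule inj_on_subset[OF inj\<pi> complex_vector.span_superset])
  have fin: "finite (G ` C1 \<union> B')" using le(1) finite_image_iff[OF inj\<pi>'] by simp
  have "card (\<pi> ` (G ` C1 \<union> B')) = card (G ` C1) + card B'"
    using fin ind(2) inj\<pi>' by (simp add: card_image card_Un_disjoint)
  also have "card (G ` C1) = card C1"
    by (rule card_image[OF inj_on_subset[OF injGC1 complex_vector.span_superset]])
  finally have "card C1 + card B' \<le> card C" using le(2) by simp
  moreover have "card C = card C1 + card B"
    unfolding C_eq by (simp add: card_Un_disjoint[OF finC1 finEB disjC] card_image[OF injEB])
  ultimately show ?le using B(4) B'(4) by (simp add: K_def K'_def)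
qed

text \<open>The inequality applies to \<open>L\<close> and to \<open>L'\<close>, each being the
  adjoint of the other.\<close>

lemma fredholm_alternative:
  assumes L: "hilbert_schmidt e L" and L': "hilbert_schmidt e L'"
    and adj: "\<And>x y. cinner (L x) y = cinner x (L' y)"
  shows "complex_vector.dim {x. x + L' x = 0} = complex_vector.dim {x. x + L x = 0}"
  using fredholm_alternative_le(2)[OF L adj] fredholm_alternative_le(2)[OF L' adjoint_swap[OF adj]]
  by (rule antisym)

end

section \<open>Hilbert--Schmidt operators\<close>

context hilbert_basis
begin

lemma hilbert_schmidt_bounded_clinear: "hilbert_schmidt e T \<Longrightarrow> bounded_clinear T"
  by (simp add: hilbert_schmidt_def)

lemma hilbert_schmidt_plus:
  assumes S: "hilbert_schmidt e S" and T: "hilbert_schmidt e T"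
  shows "hilbert_schmidt e (\<lambda>x. S x + T x)"
  unfolding hilbert_schmidt_def
proof
  show "bounded_clinear (\<lambda>x. S x + T x)"
    by (rule bounded_clinear_plus[OF hilbert_schmidt_bounded_clinear[OF S]
          hilbert_schmidt_bounded_clinear[OF T]])
  show "summable (\<lambda>n. (norm (S (e n) + T (e n)))\<^sup>2)"
  proof (rule summable_comparison_test')
    show "summable (\<lambda>n. 2 * (norm (S (e n)))\<^sup>2 + 2 * (norm (T (e n)))\<^sup>2)"
      using S T by (intro summable_add summable_mult) (auto simp: hilbert_schmidt_def)
    fix n
    have "(norm (S (e n) + T (e n)))\<^sup>2 \<le> (norm (S (e n)) + norm (T (e n)))\<^sup>2"
      by (intro power_mono norm_triangle_ineq) simp
    also have "\<dots> \<le> 2 * (norm (S (e n)))\<^sup>2 + 2 * (norm (T (e n)))\<^sup>2"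
      using sum_squares_bound[of "norm (S (e n))" "norm (T (e n))"]
      by (simp add: power2_sum)
    finally show "norm ((norm (S (e n) + T (e n)))\<^sup>2) \<le>
      2 * (norm (S (e n)))\<^sup>2 + 2 * (norm (T (e n)))\<^sup>2" by simp
  qed
qed

lemma hilbert_schmidt_compose:
  assumes S: "bounded_clinear S" and T: "hilbert_schmidt e T"
  shows "hilbert_schmidt e (\<lambda>x. S (T x))"
  unfolding hilbert_schmidt_def
proof
  show "bounded_clinear (\<lambda>x. S (T x))"
    by (rule bounded_clinear_compose[OF S hilbert_schmidt_bounded_clinear[OF T]])
  obtain K where K: "\<And>x. norm (S x) \<le> norm x * K" "K > 0"
    using bounded_linear.pos_bounded[OF bounded_clinear_bounded_linear[OF S]] by blast
  show "summable (\<lambda>n. (norm (S (T (e n))))\<^sup>2)"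
  proof (rule summable_comparison_test')
    show "summable (\<lambda>n. (norm (T (e n)))\<^sup>2 * K\<^sup>2)"
      using T by (intro summable_mult2) (auto simp: hilbert_schmidt_def)
    show "norm ((norm (S (T (e n))))\<^sup>2) \<le> (norm (T (e n)))\<^sup>2 * K\<^sup>2" for n
      using power_mono[OF K(1)[of "T (e n)"], of 2] by (simp add: power_mult_distrib)
  qed
qed

text \<open>A diagonal factor on the right merely rescales the summands taken along the same basis,
  by factors bounded by \<open>M\<close>.\<close>

lemma hilbert_schmidt_compose_diag:
  assumes T: "hilbert_schmidt e T" and d: "bounded (range d)"
  shows "hilbert_schmidt e (\<lambda>x. T (diag e d x))"
  unfolding hilbert_schmidt_def
proof
  have lin: "bounded_clinear T" by (rule hilbert_schmidt_bounded_clinear[OF T])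
  show "bounded_clinear (\<lambda>x. T (diag e d x))"
    by (rule bounded_clinear_compose[OF lin bounded_clinear_diag[OF d]])
  obtain M where M: "\<And>n. cmod (d n) \<le> M" using d by (auto simp: bounded_iff)
  show "summable (\<lambda>n. (norm (T (diag e d (e n))))\<^sup>2)"
  proof (rule summable_comparison_test')
    show "summable (\<lambda>n. M\<^sup>2 * (norm (T (e n)))\<^sup>2)"
      using T by (intro summable_mult) (auto simp: hilbert_schmidt_def)
    show "norm ((norm (T (diag e d (e n))))\<^sup>2) \<le> M\<^sup>2 * (norm (T (e n)))\<^sup>2" for n
      by (auto simp: diag_basis[OF d] bounded_clinear_scaleC[OF lin] norm_scaleC power_mult_distrib
          intro!: mult_right_mono power_mono M)
  qed
qed

lemma hilbert_schmidt_diag: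
  assumes d: "finite {n. d n \<noteq> 0}"
  shows "hilbert_schmidt e (diag e d)"
proof -
  have "range d \<subseteq> insert 0 (d ` {n. d n \<noteq> 0})" by auto
  then have b: "bounded (range d)"
    using d by (intro finite_imp_bounded finite_subset[of "range d"]) auto
  have "summable (\<lambda>n. (norm (diag e d (e n)))\<^sup>2)"
    by (rule summable_finite[OF d]) (simp add: diag_basis[OF b] norm_scaleC)
  then show ?thesis by (simp add: hilbert_schmidt_def bounded_clinear_diag[OF b])
qed


section \<open>Essential codimension of a compressed unitary\<close>

lemma subspace_kernel: "bounded_clinear T \<Longrightarrow> complex_vector.subspace {x. T x = 0}"
  by (intro complex_vector_pair.linear_subspace_kernel bounded_clinear_linear)

lemma independent_basis: "complex_vector.independent (e ` S)"
  unfolding complex_vector.independent_explicit_module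
proof (intro allI impI)
  fix t u v assume t: "finite t" "t \<subseteq> e ` S" "(\<Sum>v\<in>t. u v *\<^sub>C v) = 0" "v \<in> t"
  then obtain n where v: "v = e n" by blast
  have "(\<Sum>w\<in>t. u w * cinner w v) = cinner (\<Sum>w\<in>t. u w *\<^sub>C w) v"
    by (simp add: cinner.sum_left cinner_scaleC_left)
  also have "\<dots> = 0" by (simp add: t cinner.zero_left)
  also have "(\<Sum>w\<in>t. u w * cinner w v) = (\<Sum>w\<in>t. if w = v then u v else 0)"
    using t(2) by (intro sum.cong refl) (auto simp: v cinner_basis split: if_splits)
  finally show "u v = 0" using t by simp
qed

lemma inj_basis: "inj e"
proof (rule injI)
  fix m n assume "e m = e n"
  then show "m = n" using cinner_basis[of m n] cinner_basis[of n n] by (simp split: if_splits)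
qed

text \<open>The two conditions force all coordinates outside \<open>A - B\<close> to vanish, so the
  vectors \<open>e n\<close> with \<open>n\<close> in \<open>A - B\<close> form a basis.\<close>

lemma dim_basis_Diff:
  assumes "finite (A - B)"
  shows "complex_vector.dim {y. diag e (indicator A) y = y \<and> diag e (indicator B) y = 0} = card (A - B)"
proof (rule complex_vector.dim_unique)
  show "e ` (A - B) \<subseteq> {y. diag e (indicator A) y = y \<and> diag e (indicator B) y = 0}"
    by (auto simp: diag_basis[OF bounded_range_indicator])
  show "{y. diag e (indicator A) y = y \<and> diag e (indicator B) y = 0} \<subseteq> complex_vector.span (e ` (A - B))"
  proof
    fix y assume "y \<in> {y. diag e (indicator A) y = y \<and> diag e (indicator B) y = 0}"
    then have y: "diag e (indicator A) y = y" "diag e (indicator B) y = 0" by auto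
    have *: "cinner y (e n) = 0" if "n \<notin> A - B" for n
      using diag_indicator_coeff[of A y n] diag_indicator_coeff[of B y n] that
      by (auto simp: y cinner.zero_left)
    have "y = (\<Sum>n\<in>A - B. cinner y (e n) *\<^sub>C e n)"
      by (rule coeff_ext) (use assms * in \<open>auto simp: cinner.sum_left cinner_scaleC_left
        cinner_basis if_distrib[of "(*) _"] cong: if_cong\<close>)
    also have "\<dots> \<in> complex_vector.span (e ` (A - B))"
      by (intro complex_vector.span_sum complex_vector.span_scale complex_vector.span_base imageI)
    finally show "y \<in> complex_vector.span (e ` (A - B))" .
  qed
  show "card (e ` (A - B)) = card (A - B)"
    by (rule card_image) (rule inj_on_subset[OF inj_basis subset_UNIV])
qed (rule independent_basis)

text \<open>
  With \<open>R\<close>, \<open>Q\<close> the diagonal projections onto \<open>A\<close>, \<open>B\<close> and \<open>U = 1 + K\<close>, the operator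
  \<open>1 + compression K A B\<close> is \<open>R U Q + (1 - R) (1 - Q)\<close>, which extends the block \<open>R U Q\<close> of \<open>U\<close>
  to a Hilbert--Schmidt perturbation of the identity.
\<close>

definition compression :: "('a \<Rightarrow> 'a) \<Rightarrow> nat set \<Rightarrow> nat set \<Rightarrow> 'a \<Rightarrow> 'a" where
  "compression K A B x = diag e (indicator A) (K (diag e (indicator B) x)) +
     diag e (\<lambda>n. - indicator (A - B \<union> (B - A)) n) x"

lemma bounded_range_minus_indicator: "bounded (range (\<lambda>n. - indicator A n :: complex))" for A :: "nat set"
  by (auto intro!: boundedI[of _ 1] simp: indicator_def)

text \<open>The diagonal correction is supported on the symmetric difference of \<open>A\<close> and
  \<open>B\<close>, so it has finite rank; the other summand contains the factor
  \<open>K\<close>.\<close>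

lemma hilbert_schmidt_compression:
  assumes K: "hilbert_schmidt e K" and fin: "finite (A - B)" "finite (B - A)"
  shows "hilbert_schmidt e (compression K A B)"
proof -
  have "finite {n. - indicator (A - B \<union> (B - A)) n \<noteq> (0 :: complex)}"
    by (rule finite_subset[of _ "A - B \<union> (B - A)"]) (use fin in \<open>auto simp: indicator_def\<close>)
  then show ?thesis
    unfolding compression_def
    by (intro hilbert_schmidt_plus[OF hilbert_schmidt_compose[OF bounded_clinear_diag[OF bounded_range_indicator]
        hilbert_schmidt_compose_diag[OF K bounded_range_indicator]] hilbert_schmidt_diag])
qed

text \<open>Passing to the adjoint reverses the order of the two projections, hence exchanges
  \<open>A\<close> and \<open>B\<close>.\<close>

lemma cinner_compression:
  assumes adj: "\<And>x y. cinner (K x) y = cinner x (K' y)"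
  shows "cinner (compression K A B x) y = cinner x (compression K' B A y)"
proof -
  have "(\<lambda>n. cnj (- indicator (A - B \<union> (B - A)) n)) = (\<lambda>n. - indicator (B - A \<union> (A - B)) n)"
    by (auto simp: indicator_def)
  then show ?thesis
    by (simp add: compression_def cinner_add_left cinner_add_right cinner_diag_indicator adj
        cinner_diag[OF bounded_range_minus_indicator])
qed

text \<open>With \<open>R\<close> and \<open>Q\<close> the projections for \<open>A\<close> and
  \<open>B\<close>, this rests on \<open>R + Q - 2 R Q\<close> being the projection onto the
  symmetric difference.\<close>

lemma id_plus_compression:
  assumes K: "bounded_clinear K"
  shows "x + compression K A B x =
    diag e (indicator A) (diag e (indicator B) x + K (diag e (indicator B) x)) +
    (x - diag e (indicator B) x - diag e (indicator A) (x - diag e (indicator B) x))"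
  by (rule coeff_ext, unfold compression_def cinner_add_left cinner.diff_left diag_indicator_coeff
      diag_coeff[OF bounded_range_minus_indicator]) (simp add: indicator_def)

text \<open>The two blocks of \<open>1 + compression K A B\<close> take values in the range of
  \<open>R\<close> and in its complement, so they vanish separately. Splitting \<open>x\<close> into
  \<open>Q x\<close> and \<open>x - Q x\<close> decomposes the kernel into that of the block
  \<open>R U Q\<close>, where \<open>U = 1 + K\<close>, and the span of the basis vectors indexed by
  \<open>A - B\<close>.\<close>

lemma dim_kernel_compression:
  assumes K: "hilbert_schmidt e K" and fin: "finite (A - B)" "finite (B - A)"
  shows "complex_vector.dim {x. x + compression K A B x = 0} =
    complex_vector.dim {y. diag e (indicator B) y = y \<and> diag e (indicator A) (y + K y) = 0} + card (A - B)"
proof -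
  define R where "R = diag e (indicator A)"
  define Q where "Q = diag e (indicator B)"
  have lin: "bounded_clinear R" "bounded_clinear Q" "bounded_clinear K"
    using hilbert_schmidt_bounded_clinear[OF K] by (simp_all add: R_def Q_def bounded_clinear_diag)
  have idem: "R (R x) = R x" "Q (Q x) = Q x" for x
    by (simp_all add: R_def Q_def diag_indicator_diag_indicator)
  note ops = bounded_clinear_add[OF lin(1)] bounded_clinear_add[OF lin(2)] bounded_clinear_add[OF lin(3)]
    bounded_clinear_diff[OF lin(1)] bounded_clinear_diff[OF lin(2)]
    bounded_clinear_zero[OF lin(1)] bounded_clinear_zero[OF lin(2)] bounded_clinear_zero[OF lin(3)]
    bounded_clinear_scaleC[OF lin(1)] bounded_clinear_scaleC[OF lin(2)] bounded_clinear_scaleC[OF lin(3)]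
  have G: "x + compression K A B x = R (Q x + K (Q x)) + (x - Q x - R (x - Q x))" for x
    unfolding R_def Q_def by (rule id_plus_compression[OF lin(3)])
  let ?M = "{y. Q y = y \<and> R (y + K y) = 0}" and ?Y = "{y. R y = y \<and> Q y = 0}"
  have eq: "{x. x + compression K A B x = 0} = {v + w | v w. v \<in> ?M \<and> w \<in> ?Y}"
  proof (intro set_eqI iffI)
    fix x assume "x \<in> {x. x + compression K A B x = 0}"
    then have x: "R (Q x + K (Q x)) + (x - Q x - R (x - Q x)) = 0" by (simp add: G)
    \<comment> \<open>Applying \<open>R\<close> removes the second block and isolates the
      first.\<close>
    then have "R (R (Q x + K (Q x)) + (x - Q x - R (x - Q x))) = 0" by (simp add: ops)
    then have 1: "R (Q x + K (Q x)) = 0" by (simp add: ops idem)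
    then have "R (x - Q x) = x - Q x" using x by simp
    then have "Q x \<in> ?M" "x - Q x \<in> ?Y" using 1 by (simp_all add: ops idem)
    then show "x \<in> {v + w | v w. v \<in> ?M \<and> w \<in> ?Y}"
      by (intro CollectI exI[of _ "Q x"] exI[of _ "x - Q x"]) simp
  next
    fix x assume "x \<in> {v + w | v w. v \<in> ?M \<and> w \<in> ?Y}"
    then obtain v w where "x = v + w" "Q v = v" "R (v + K v) = 0" "R w = w" "Q w = 0" by blast
    then show "x \<in> {x. x + compression K A B x = 0}" by (simp add: G ops)
  qed
  have "complex_vector.dim {v + w | v w. v \<in> ?M \<and> w \<in> ?Y} =
      complex_vector.dim ?M + complex_vector.dim ?Y"
  proof -
    have HS: "hilbert_schmidt e (compression K A B)" by (rule hilbert_schmidt_compression[OF K fin])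
    \<comment> \<open>Finite-dimensionality of the kernel is what allows the dimensions of the
      summands to be added.\<close>
    have "\<exists>A'. finite A' \<and> {x. x + compression K A B x = 0} \<subseteq> complex_vector.span A'"
      by (rule fredholm_alternative_le(1)[OF HS cinner_cadjoint[OF hilbert_schmidt_bounded_clinear[OF HS]]])
    then obtain A' where A': "finite A'" "{v + w | v w. v \<in> ?M \<and> w \<in> ?Y} \<subseteq> complex_vector.span A'"
      unfolding eq by blast
    show ?thesis
    proof (rule dim_direct_sum[OF _ _ _ A'])
      have "?M = {y. y - Q y = 0} \<inter> {y. R (y + K y) = 0}" "?Y = {y. y - R y = 0} \<inter> {y. Q y = 0}"
        by auto
      then show "complex_vector.subspace ?M" "complex_vector.subspace ?Y"
        using subspace_kernel[OF bounded_clinear_minus[OF bounded_clinear_id lin(2)]]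
          subspace_kernel[OF bounded_clinear_compose[OF lin(1)
            bounded_clinear_plus[OF bounded_clinear_id lin(3)]]]
          subspace_kernel[OF bounded_clinear_minus[OF bounded_clinear_id lin(1)]]
          subspace_kernel[OF lin(2)]
        by (simp_all add: complex_vector.subspace_inter)
    qed auto
  qed
  then show ?thesis
    unfolding eq using dim_basis_Diff[OF fin(1)] by (simp add: R_def Q_def)
qed

text \<open>The unitary carries the kernel of \<open>Q P\<close> on the range of \<open>P\<close> to
  the kernel \<open>?M1\<close> of \<open>Q U'\<close> on the range of \<open>R\<close>, while the
  cokernel is the kernel \<open>?M2\<close> of \<open>R U\<close> on the range of \<open>Q\<close>.
  Each is a block of the kernel of a compression, the other block having dimension
  \<open>card (B - A)\<close> or \<open>card (A - B)\<close> respectively.\<close>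

lemma essential_codim_unitary_diag:
  assumes K: "hilbert_schmidt e K" and K': "hilbert_schmidt e K'"
    and adjK: "\<And>x y. cinner (K x) y = cinner x (K' y)"
    and U: "\<And>x. U x = x + K x" and U': "\<And>x. U' x = x + K' x"
    and inv: "\<And>x. U (U' x) = x" "\<And>x. U' (U x) = x"
    and fin: "finite (A - B)" "finite (B - A)"
  shows "essential_codim (\<lambda>x. U' (diag e (indicator A) (U x))) (diag e (indicator B)) =
    int (card (A - B)) - int (card (B - A))"
proof -
  define R where "R = diag e (indicator A)"
  define Q where "Q = diag e (indicator B)"
  define P where "P x = U' (R (U x))" for x
  have idem: "R (R x) = R x" "Q (Q x) = Q x" for x
    by (simp_all add: R_def Q_def diag_indicator_diag_indicator)
  have sa: "cinner (R x) y = cinner x (R y)" "cinner (Q x) y = cinner x (Q y)" for x y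
    unfolding R_def Q_def by (rule cinner_diag_indicator)+
  have adj: "cinner (U x) y = cinner x (U' y)" for x y
    by (simp add: U U' cinner_add_left cinner_add_right adjK)
  note adj' = adjoint_swap[OF adj]
  have linU': "bounded_clinear U'"
    unfolding U'[abs_def]
    by (rule bounded_clinear_plus[OF bounded_clinear_id hilbert_schmidt_bounded_clinear[OF K']])
  have linR: "bounded_clinear R" and linQ: "bounded_clinear Q"
    by (simp_all add: R_def Q_def bounded_clinear_diag)
  have injU': "inj U'" using inv(1) by (metis injI)
  have PP: "P (P x) = P x" for x by (simp add: P_def inv idem)
  have saP: "cinner (P x) y = cinner x (P y)" for x y by (simp add: P_def adj adj' sa)
  let ?M1 = "{y. R y = y \<and> Q (y + K' y) = 0}" and ?M2 = "{y. Q y = y \<and> R (y + K y) = 0}"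
  have P0: "P y = 0 \<longleftrightarrow> R (U y) = 0" for y
    using injD[OF injU', of "R (U y)" 0] bounded_clinear_zero[OF linU'] by (auto simp: P_def)
  have 1: "{x \<in> range P. (Q \<circ> P) x = 0} = U' ` ?M1"
  proof (intro set_eqI iffI)
    fix x assume "x \<in> {x \<in> range P. (Q \<circ> P) x = 0}"
    then have "P x = x" "Q x = 0" using PP by auto
    then have "R (U x) = U x" "x = U' (U x)" using inv by (metis P_def)+
    then have "U x \<in> ?M1" using \<open>Q x = 0\<close> by (simp add: U'[symmetric])
    with \<open>x = U' (U x)\<close> show "x \<in> U' ` ?M1" by blast
  next
    fix x assume "x \<in> U' ` ?M1"
    then obtain y where y: "x = U' y" "R y = y" "Q (U' y) = 0" by (auto simp: U')
    then have "P x = x" by (simp add: P_def inv)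
    then show "x \<in> {x \<in> range P. (Q \<circ> P) x = 0}"
      using y by (auto intro: range_eqI[of _ _ x])
  qed
  have 2: "{y \<in> range Q. \<forall>x\<in>range P. cinner ((Q \<circ> P) x) y = 0} = ?M2"
  proof (intro set_eqI iffI)
    fix y assume y: "y \<in> {y \<in> range Q. \<forall>x\<in>range P. cinner ((Q \<circ> P) x) y = 0}"
    then have Qy: "Q y = y" using idem by auto
    \<comment> \<open>Orthogonality of \<open>y\<close> to the range of \<open>Q P\<close> amounts
      to \<open>P y = 0\<close>, because \<open>Q\<close> fixes \<open>y\<close> and both
      projections are self-adjoint.\<close>
    have "cinner x (P y) = 0" for x
    proof -
      have "cinner ((Q \<circ> P) (P x)) y = 0" using y by blast
      then show ?thesis by (simp add: PP sa Qy saP)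
    qed
    then have "P y = 0" by (rule cinner_eq_0_right)
    then show "y \<in> ?M2" using Qy by (simp add: P0 U[symmetric])
  next
    fix y assume "y \<in> ?M2"
    then have y: "Q y = y" "P y = 0" by (simp_all add: P0 U)
    then have "P 0 = 0" using PP[of y] by simp
    with y show "y \<in> {y \<in> range Q. \<forall>x\<in>range P. cinner ((Q \<circ> P) x) y = 0}"
      by (auto simp: sa saP cinner.zero_right intro: range_eqI[of _ _ y])
  qed
  have subM1: "complex_vector.subspace ?M1"
  proof -
    have "?M1 = {y. y - R y = 0} \<inter> {y. Q (U' y) = 0}" by (auto simp: U')
    then show ?thesis
      using subspace_kernel[OF bounded_clinear_minus[OF bounded_clinear_id linR]]
        subspace_kernel[OF bounded_clinear_compose[OF linQ linU']]
      by (simp add: complex_vector.subspace_inter)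
  qed
  have "essential_codim P Q = int (complex_vector.dim ?M1) - int (complex_vector.dim ?M2)"
    unfolding essential_codim_def fredholm_index_def 1 2
    using dim_injective_image[OF bounded_clinear_linear[OF linU'] inj_on_subset[OF injU' subset_UNIV] subM1]
    by simp
  \<comment> \<open>The sides are the kernel dimensions of two mutually adjoint operators, equal by
    the Fredholm alternative.\<close>
  moreover have "complex_vector.dim ?M1 + card (B - A) = complex_vector.dim ?M2 + card (A - B)"
    using fredholm_alternative[OF hilbert_schmidt_compression[OF K fin]
        hilbert_schmidt_compression[OF K' fin(2,1)] cinner_compression[OF adjK]]
      dim_kernel_compression[OF K fin] dim_kernel_compression[OF K' fin(2,1)]
    by (simp add: R_def Q_def)
  ultimately have "essential_codim P Q = int (card (A - B)) - int (card (B - A))" by linarith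
  then show ?thesis by (simp add: P_def[abs_def] R_def Q_def)
qed

end

section \<open>The trace of the conditional expectation\<close>

text \<open>Stated for a general weight \<open>h\<close>: the identity yields the trace, and the
  constant 1 yields the sum of the coefficients.\<close>

lemma sum_fibres:
  fixes h :: "'b \<Rightarrow> 'c::semiring_1"
  assumes "finite F" "finite X" "f ` F \<subseteq> X"
  shows "(\<Sum>n\<in>F. h (f n)) = (\<Sum>\<mu>\<in>X. of_nat (card {n \<in> F. f n = \<mu>}) * h \<mu>)"
proof -
  have "(\<Sum>n\<in>F. h (f n)) = (\<Sum>\<mu>\<in>X. \<Sum>n\<in>{n \<in> F. f n = \<mu>}. h (f n))"
    by (rule sum.group[OF assms, symmetric])
  also have "\<dots> = (\<Sum>\<mu>\<in>X. of_nat (card {n \<in> F. f n = \<mu>}) * h \<mu>)"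
    by (intro sum.cong refl) simp
  finally show ?thesis .
qed

context
  fixes d d' :: "nat \<Rightarrow> complex" and X :: "complex set"
  assumes X: "finite X" and d: "range d \<subseteq> X" and d': "range d' \<subseteq> X"
begin

text \<open>The terms tend to 0 but take only finitely many values, so they are eventually 0: the
  complement of the finite set \<open>Y\<close> of nonzero differences is a neighbourhood of
  0.\<close>

lemma finite_disagreement:
  assumes "summable (\<lambda>n. d n - d' n)"
  shows "finite {n. d n \<noteq> d' n}"
proof -
  define Y where "Y = (\<lambda>(x, y). x - y) ` (X \<times> X) - {0}"
  have "finite Y" using X by (simp add: Y_def)
  then have "open (- Y)" by (simp add: open_Compl finite_imp_closed)
  moreover have "0 \<in> - Y" by (simp add: Y_def)
  ultimately have "\<forall>\<^sub>F n in sequentially. d n - d' n \<in> - Y"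
    using topological_tendstoD[OF summable_LIMSEQ_zero[OF assms]] by blast
  then obtain m where m: "\<And>n. n \<ge> m \<Longrightarrow> d n - d' n \<in> - Y"
    by (auto simp: eventually_sequentially)
  have "d n = d' n" if "n \<ge> m" for n
  proof (rule ccontr)
    assume "d n \<noteq> d' n"
    moreover have "d n \<in> X" "d' n \<in> X" using d d' by auto
    ultimately have "d n - d' n \<in> Y" unfolding Y_def by force
    then show False using m[OF that] by simp
  qed
  then have "{n. d n \<noteq> d' n} \<subseteq> {..<m}" by (auto simp: not_le[symmetric])
  then show ?thesis by (rule finite_subset) simp
qed

text \<open>Grouping the finite sum by the values of \<open>d\<close> and of \<open>d'\<close>
  produces the coefficients \<open>c\<close>. They add up to 0 because both groupings partition the
  same set of indices.\<close>

lemma sums_disagreement: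
  assumes fin: "finite {n. d n \<noteq> d' n}"
  defines "c \<equiv> \<lambda>\<mu>. int (card (d -` {\<mu>} - d' -` {\<mu>})) - int (card (d' -` {\<mu>} - d -` {\<mu>}))"
  shows "(\<lambda>n. d n - d' n) sums (\<Sum>\<mu>\<in>X. of_int (c \<mu>) * \<mu>)" "(\<Sum>\<mu>\<in>X. c \<mu>) = 0"
proof -
  let ?F = "{n. d n \<noteq> d' n}"
  have im: "d ` ?F \<subseteq> X" "d' ` ?F \<subseteq> X" using d d' by auto
  have eq: "d -` {\<mu>} - d' -` {\<mu>} = {n \<in> ?F. d n = \<mu>}" "d' -` {\<mu>} - d -` {\<mu>} = {n \<in> ?F. d' n = \<mu>}" for \<mu>
    by auto
  have "(\<lambda>n. d n - d' n) sums (\<Sum>n\<in>?F. d n - d' n)"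
    by (rule sums_finite[OF fin]) auto
  also have "(\<Sum>n\<in>?F. d n - d' n) = (\<Sum>\<mu>\<in>X. of_int (c \<mu>) * \<mu>)"
    using sum_fibres[OF fin X im(1), of "\<lambda>z. z"] sum_fibres[OF fin X im(2), of "\<lambda>z. z"]
    by (simp add: sum_subtractf c_def eq left_diff_distrib)
  finally show "(\<lambda>n. d n - d' n) sums (\<Sum>\<mu>\<in>X. of_int (c \<mu>) * \<mu>)" .
  show "(\<Sum>\<mu>\<in>X. c \<mu>) = 0"
    using sum_fibres[OF fin X im(1), of "\<lambda>_. 1 :: int"] sum_fibres[OF fin X im(2), of "\<lambda>_. 1 :: int"]
    by (simp add: sum_subtractf c_def eq)
qed

end

context hilbert_basis
begin

text \<open>With \<open>D = diag e d\<close>, this is \<open>Tr (K\<^sup>* D K) = Tr (D K K\<^sup>*)\<close>.\<close>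

lemma hilbert_schmidt_trace_swap:
  assumes K: "hilbert_schmidt e K" and K': "hilbert_schmidt e K'"
    and adj: "\<And>x y. cinner (K x) y = cinner x (K' y)" and d: "bounded (range d)"
  shows "summable (\<lambda>n. cmod (cinner (diag e d (K (e n))) (K (e n))))"
    and "summable (\<lambda>n. cmod (d n * of_real ((norm (K' (e n)))\<^sup>2)))"
    and "(\<Sum>n. cinner (diag e d (K (e n))) (K (e n))) = (\<Sum>n. d n * of_real ((norm (K' (e n)))\<^sup>2))"
proof -
  obtain M where M: "\<And>n. cmod (d n) \<le> M" using d by (auto simp: bounded_iff)
  \<comment> \<open>Squared moduli of the matrix entries of \<open>K\<close>. By Parseval, summing
    over \<open>k\<close> gives the squared norm of \<open>K (e n)\<close>, and summing over
    \<open>n\<close> that of \<open>K' (e k)\<close>.\<close>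
  define c where "c n k = (cmod (cinner (K (e n)) (e k)))\<^sup>2" for n k
  define f where "f n k = d k * of_real (c n k)" for n k
  have c0: "0 \<le> c n k" for n k by (simp add: c_def)
  have c_eq: "c n k = (cmod (cinner (K' (e k)) (e n)))\<^sup>2" for n k
    by (simp add: c_def adj) (metis cinner_commute complex_mod_cnj)
  have c_row: "(c n) sums (norm (K (e n)))\<^sup>2" for n
    unfolding c_def by (rule parseval_norm)
  have c_col: "(\<lambda>n. c n k) sums (norm (K' (e k)))\<^sup>2" for k
    unfolding c_eq by (rule parseval_norm)
  have f_row: "f n sums cinner (diag e d (K (e n))) (K (e n))" for n
    using parseval[of "diag e d (K (e n))" "K (e n)"]
    by (simp add: f_def[abs_def] c_def diag_coeff[OF d] complex_norm_square mult.assoc del: of_real_power)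
  have f_col: "(\<lambda>n. f n k) sums (d k * of_real ((norm (K' (e k)))\<^sup>2))" for k
    unfolding f_def by (intro sums_mult sums_of_real c_col)
  have has_row: "(c n has_sum (norm (K (e n)))\<^sup>2) UNIV" for n
    by (rule norm_summable_imp_has_sum[OF _ c_row]) (use c_row c0 in \<open>simp add: sums_iff\<close>)
  have sum_K: "(\<lambda>n. (norm (K (e n)))\<^sup>2) summable_on UNIV"
    using K by (subst summable_on_UNIV_nonneg_real_iff) (auto simp: hilbert_schmidt_def)
  have f_le: "norm (f n k) \<le> M * c n k" for n k
    by (simp add: f_def norm_mult c0 mult_right_mono M)
  \<comment> \<open>The Hilbert-Schmidt condition on \<open>K\<close> says exactly that the row sums
    are summable. Absolute summability over pairs, inherited by \<open>f\<close>, is what permits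
    the interchange of sums.\<close>
  have "(\<lambda>p. norm (case p of (n, k) \<Rightarrow> c n k)) summable_on (SIGMA n:UNIV. UNIV)"
    by (rule Infinite_Sum.abs_summable_on_Sigma_iff[THEN iffD2])
      (use sum_K in \<open>simp add: c0 infsumI[OF has_row] has_sum_imp_summable[OF has_row]\<close>)
  then have "(\<lambda>p. norm (M * (case p of (n, k) \<Rightarrow> c n k))) summable_on UNIV"
    by (simp add: abs_mult summable_on_cmult_right)
  then have abs_f: "(\<lambda>p. norm (case p of (n, k) \<Rightarrow> f n k)) summable_on UNIV"
    by (rule Infinite_Sum.abs_summable_on_comparison_test)
      (auto intro!: order_trans[OF f_le] simp: c0 simp del: norm_mult)
  show s1: "summable (\<lambda>n. cmod (cinner (diag e d (K (e n))) (K (e n))))"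
  proof (rule summable_comparison_test')
    show "summable (\<lambda>n. M * (norm (K (e n)))\<^sup>2)"
      using K by (intro summable_mult) (auto simp: hilbert_schmidt_def)
    fix n
    have "cmod (cinner (diag e d (K (e n))) (K (e n))) \<le> norm (diag e d (K (e n))) * norm (K (e n))"
      by (rule cmod_cinner_le)
    also have "\<dots> \<le> M * norm (K (e n)) * norm (K (e n))"
      by (intro mult_right_mono norm_diag_le M) simp
    finally show "norm (cmod (cinner (diag e d (K (e n))) (K (e n)))) \<le> M * (norm (K (e n)))\<^sup>2"
      by (simp add: power2_eq_square mult.assoc)
  qed
  show s2: "summable (\<lambda>n. cmod (d n * of_real ((norm (K' (e n)))\<^sup>2)))"
  proof (rule summable_comparison_test')
    show "summable (\<lambda>n. M * (norm (K' (e n)))\<^sup>2)"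
      using K' by (intro summable_mult) (auto simp: hilbert_schmidt_def)
    show "norm (cmod (d n * of_real ((norm (K' (e n)))\<^sup>2))) \<le> M * (norm (K' (e n)))\<^sup>2" for n
      by (simp add: norm_mult norm_power mult_right_mono M)
  qed
  have norm_f: "summable (\<lambda>k. norm (f n k))" "summable (\<lambda>n. norm (f n k))" for n k
    using summable_comparison_test'[OF summable_mult[OF sums_summable[OF c_row]], of 0 "\<lambda>k. norm (f n k)" M n]
      summable_comparison_test'[OF summable_mult[OF sums_summable[OF c_col]], of 0 "\<lambda>n. norm (f n k)" M k]
    by (simp_all add: f_le)
  have inf_row: "infsum (f n) UNIV = cinner (diag e d (K (e n))) (K (e n))" for n
    by (rule infsumI[OF norm_summable_imp_has_sum[OF norm_f(1) f_row]])
  have inf_col: "infsum (\<lambda>n. f n k) UNIV = d k * of_real ((norm (K' (e k)))\<^sup>2)" for k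
    by (rule infsumI[OF norm_summable_imp_has_sum[OF norm_f(2) f_col]])
  have "infsum (\<lambda>n. infsum (f n) UNIV) UNIV = infsum (\<lambda>k. infsum (\<lambda>n. f n k) UNIV) UNIV"
    by (rule infsum_swap_banach) (use abs_summable_summable[OF abs_f] in simp)
  then have "infsum (\<lambda>n. cinner (diag e d (K (e n))) (K (e n))) UNIV =
      infsum (\<lambda>n. d n * of_real ((norm (K' (e n)))\<^sup>2)) UNIV"
    by (simp only: inf_row inf_col)
  moreover have "infsum a UNIV = suminf a" if "summable (\<lambda>n. cmod (a n))" for a :: "nat \<Rightarrow> complex"
    by (rule infsumI[OF norm_summable_imp_has_sum[OF that summable_sums[OF summable_norm_cancel[OF that]]]])
  ultimately show "(\<Sum>n. cinner (diag e d (K (e n))) (K (e n))) = (\<Sum>n. d n * of_real ((norm (K' (e n)))\<^sup>2))"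
    using s1 s2 by simp
qed

section \<open>Diagonal entries of \<open>N\<close> compared with the eigenvalues
  \<open>d\<close>\<close>

lemma unitary_perturbation_norm:
  assumes adj: "\<And>x y. cinner (K x) y = cinner x (K' y)"
    and inv: "\<And>x. x + K x + K' (x + K x) = x"
  shows "cinner (K x) x + cinner x (K x) = - of_real ((norm (K x))\<^sup>2)"
proof -
  have "cinner (x + K x) y = cinner x (y + K' y)" for y
    by (simp add: cinner_add_left cinner_add_right adj)
  then have "cinner (x + K x) (x + K x) = cinner x (x + K x + K' (x + K x))" .
  also have "\<dots> = cinner x x" by (simp only: inv)
  finally have "cinner x x + (cinner (K x) x + cinner x (K x) + cinner (K x) (K x)) = cinner x x"
    by (simp only: cinner_add_left cinner_add_right) (simp add: algebra_simps)
  then show ?thesis by (simp add: cinner_self eq_neg_iff_add_eq_0 del: of_real_power)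
qed

lemma diagonal_entry_unitary_diag:
  assumes adj: "\<And>x y. cinner (K x) y = cinner x (K' y)"
    and inv: "\<And>x. x + K x + K' (x + K x) = x" and d: "bounded (range d)"
    and N: "\<And>x. N x = diag e d (x + K x) + K' (diag e d (x + K x))"
  shows "cinner (N (e n)) (e n) - d n =
    cinner (diag e d (K (e n))) (K (e n)) - d n * of_real ((norm (K (e n)))\<^sup>2)"
proof -
  let ?D = "diag e d"
  have "cinner (N (e n)) (e n) = cinner (?D (e n + K (e n))) (e n + K (e n))"
    by (simp add: N cinner_add_left cinner_add_right adjoint_swap[OF adj])
  also have "\<dots> = cinner (?D (e n)) (e n) + cinner (?D (e n)) (K (e n)) + cinner (?D (K (e n))) (e n) +
      cinner (?D (K (e n))) (K (e n))"
    by (simp add: bounded_clinear_add[OF bounded_clinear_diag[OF d]] cinner_add_left cinner_add_right)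
  \<comment> \<open>Both cross terms carry the factor \<open>d n\<close>: one because
    \<open>e n\<close> is an eigenvector, the other by reading off the \<open>n\<close>-th
    coordinate. Their sum is thus governed by unitarity.\<close>
  also have "\<dots> = d n + d n * (cinner (K (e n)) (e n) + cinner (e n) (K (e n))) +
      cinner (?D (K (e n))) (K (e n))"
    by (simp add: diag_basis[OF d] diag_coeff[OF d] cinner_scaleC_left cinner_basis algebra_simps)
  also have "\<dots> = d n + d n * (- of_real ((norm (K (e n)))\<^sup>2)) + cinner (?D (K (e n))) (K (e n))"
    by (simp only: unitary_perturbation_norm[OF adj inv])
  finally show ?thesis by simp
qed

lemma trace_diagonal_deviation:
  assumes K: "hilbert_schmidt e K" and adj: "\<And>x y. cinner (K x) y = cinner x (K' y)"
    and inv: "\<And>x. x + K x + K' (x + K x) = x" "\<And>x. x + K' x + K (x + K' x) = x"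
    and d: "bounded (range d)"
    and N: "\<And>x. N x = diag e d (x + K x) + K' (diag e d (x + K x))"
  shows "hilbert_schmidt e K'"
    and "summable (\<lambda>n. cmod (cinner (N (e n)) (e n) - d n))"
    and "(\<lambda>n. cinner (N (e n)) (e n) - d n) sums 0"
proof -
  note adj' = adjoint_swap[OF adj]
  have K'lin: "bounded_clinear K'"
    by (rule adjoint_bounded_clinear[OF hilbert_schmidt_bounded_clinear[OF K] adj])
  \<comment> \<open>Unitarity in both orders expresses the two squared norms through the same real
    part. Hence \<open>K'\<close> is Hilbert-Schmidt too, and the two sums in the swap lemma
    cancel.\<close>
  have norm_eq: "norm (K' x) = norm (K x)" for x
  proof -
    have "cinner (K x) x + cinner x (K x) = cinner (K' x) x + cinner x (K' x)"
      by (simp add: adj adj')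
    then have "complex_of_real ((norm (K x))\<^sup>2) = of_real ((norm (K' x))\<^sup>2)"
      using unitary_perturbation_norm[OF adj inv(1), of x] unitary_perturbation_norm[OF adj' inv(2), of x]
      by simp
    then show ?thesis by (simp only: of_real_eq_iff) (simp add: power2_eq_iff_nonneg)
  qed
  show K': "hilbert_schmidt e K'"
    using K K'lin by (simp add: hilbert_schmidt_def norm_eq)
  note swap = hilbert_schmidt_trace_swap[OF K K' adj d, unfolded norm_eq]
  note entry = diagonal_entry_unitary_diag[OF adj inv(1) d N]
  show "summable (\<lambda>n. cmod (cinner (N (e n)) (e n) - d n))"
    unfolding entry
    by (rule summable_comparison_test'[OF summable_add[OF swap(1,2)]]) (simp add: norm_triangle_ineq4)
  show "(\<lambda>n. cinner (N (e n)) (e n) - d n) sums 0"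
    unfolding entry
    using sums_diff[OF summable_sums[OF summable_norm_cancel[OF swap(1)]]
        summable_sums[OF summable_norm_cancel[OF swap(2)]]] swap(3) by simp
qed

text \<open>Rewrites the hypothesis as identities in \<open>K\<close> and
  \<open>K' = cadjoint U - 1\<close>, the form in which unitarity is used in the
  computations.\<close>

lemma hs_diagonalizableE:
  assumes "hs_diagonalizable e N"
  obtains K K' d where "hilbert_schmidt e K" "\<And>x y. cinner (K x) y = cinner x (K' y)"
    "\<And>x. x + K x + K' (x + K x) = x" "\<And>x. x + K' x + K (x + K' x) = x"
    "bounded (range d)" "\<And>x. N x = diag e d (x + K x) + K' (diag e d (x + K x))"
proof -
  obtain U K where U: "unitary_op U" and K: "hilbert_schmidt e K" and UK: "U = (\<lambda>x. x + K x)"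
    and diagonal: "diagonal_op e (U \<circ> N \<circ> cadjoint U)"
    using assms by (auto simp: hs_diagonalizable_def)
  obtain d where d: "bounded (range d)" and D: "U \<circ> N \<circ> cadjoint U = diag e d"
    by (rule diagonal_opE[OF diagonal])
  define K' where "K' x = cadjoint U x - x" for x
  have lin: "bounded_clinear U" using U by (simp add: unitary_op_def)
  have inv: "U (cadjoint U x) = x" "cadjoint U (U x) = x" for x
    using U by (simp_all add: unitary_op_def fun_eq_iff)
  have Ux: "U x = x + K x" for x by (simp add: UK)
  have U': "cadjoint U x = x + K' x" for x by (simp add: K'_def)
  have "cinner (x + K x) y = cinner x (y + K' y)" for x y
    using cinner_cadjoint[OF lin, of x y] unfolding U' by (simp add: Ux)
  then have adj: "cinner (K x) y = cinner x (K' y)" for x y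
    by (simp add: cinner_add_left cinner_add_right)
  have N: "N x = cadjoint U (diag e d (U x))" for x
  proof -
    have "diag e d (U x) = U (N x)" using fun_cong[OF D, of "U x"] by (simp add: inv)
    then show ?thesis by (simp add: inv)
  qed
  show ?thesis
    by (rule that[OF K adj _ _ d]) (use inv N in \<open>simp_all add: U' Ux\<close>)
qed

end


theorem theorem4p3:
  fixes e :: "nat \<Rightarrow> 'a::chilbert_space"
    and N :: "'a \<Rightarrow> 'a"
  assumes "orthonormal_basis e"
    and "normal_op N"
    and "finite (spectrum N)"
    and "hs_diagonalizable e N"
  shows "(\<exists>N'. diagonal_op e N' \<and> spectrum N' \<subseteq> spectrum N \<and>
               trace_class e (cond_exp e (\<lambda>x. N x - N' x))) \<and>
         (\<forall>N'. diagonal_op e N' \<and> spectrum N' \<subseteq> spectrum N \<and>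
               trace_class e (cond_exp e (\<lambda>x. N x - N' x)) \<longrightarrow>
            trace_op e (cond_exp e (\<lambda>x. N x - N' x)) \<in> K_module (spectrum N) \<and>
            trace_op e (cond_exp e (\<lambda>x. N x - N' x)) =
              (\<Sum>\<mu>\<in>spectrum N.
                 of_int (essential_codim (spectral_proj N \<mu>) (spectral_proj N' \<mu>)) * \<mu>) \<and>
            (\<forall>\<mu>\<in>spectrum N.
               hilbert_schmidt e (\<lambda>x. spectral_proj N \<mu> x - spectral_proj N' \<mu> x)))"
proof -
  interpret hilbert_basis e by unfold_locales (rule assms(1))
  obtain K K' d where K: "hilbert_schmidt e K" and adjK: "\<And>x y. cinner (K x) y = cinner x (K' y)"
    and inv: "\<And>x. x + K x + K' (x + K x) = x" "\<And>x. x + K' x + K (x + K' x) = x"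
    and d: "bounded (range d)" and N: "\<And>x. N x = diag e d (x + K x) + K' (diag e d (x + K x))"
    by (rule hs_diagonalizableE[OF assms(4)]) (rule that)
  define U where "U x = x + K x" for x
  define U' where "U' x = x + K' x" for x
  note dev = trace_diagonal_deviation[OF K adjK inv d N]
  have linN: "bounded_clinear N" using assms(2) by (simp add: normal_op_def)
  have linU: "bounded_clinear U"
    unfolding U_def by (rule bounded_clinear_plus[OF bounded_clinear_id hilbert_schmidt_bounded_clinear[OF K]])
  have linU': "bounded_clinear U'"
    unfolding U'_def by (rule bounded_clinear_plus[OF bounded_clinear_id hilbert_schmidt_bounded_clinear[OF dev(1)]])
  have adj: "cinner (U x) y = cinner x (U' y)" for x y
    by (simp add: U_def U'_def cinner_add_left cinner_add_right adjK)
  have invU: "U (U' x) = x" "U' (U x) = x" for x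
    using inv by (simp_all add: U_def U'_def)
  have NU: "N x = U' (diag e d (U x))" for x by (simp add: N U_def U'_def)
  note dN = unitary_diag_entries_in_spectrum[OF linU adj invU d NU]
  have P: "spectral_proj N \<mu> = (\<lambda>x. U' (diag e (indicator (d -` {\<mu>})) (U x)))" for \<mu>
    by (rule spectral_proj_unitary_diag[OF linU adj invU d NU assms(3)])
  show ?thesis
  proof (intro conjI allI impI ballI)

    \<comment> \<open>Existence: the diagonal operator unitarily equivalent to \<open>N\<close> is
      admissible\<close>
    have "spectrum (diag e d) \<subseteq> spectrum N"
    proof
      fix \<mu> assume \<mu>: "\<mu> \<in> spectrum (diag e d)"
      show "\<mu> \<in> spectrum N"
      proof (rule ccontr)
        assume "\<mu> \<notin> spectrum N"
        then obtain S where S: "bounded_clinear S"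
          and S1: "S \<circ> (\<lambda>x. N x - \<mu> *\<^sub>C x) = id" and S2: "(\<lambda>x. N x - \<mu> *\<^sub>C x) \<circ> S = id"
          by (auto simp: spectrum_def invertible_op_def)
        have D: "diag e d x - \<mu> *\<^sub>C x = U (N (U' x) - \<mu> *\<^sub>C U' x)" for x
          by (simp add: NU invU bounded_clinear_diff[OF linU] bounded_clinear_scaleC[OF linU])
        have "invertible_op (\<lambda>x. diag e d x - \<mu> *\<^sub>C x)"
          unfolding invertible_op_def
        \<comment> \<open>Conjugating the resolvent \<open>S\<close> of \<open>N\<close> at
          \<open>\<mu>\<close> by the unitary inverts \<open>diag e d - \<mu>\<close>.\<close>
        proof (intro conjI exI[of _ "\<lambda>x. U (S (U' x))"])
          show "bounded_clinear (\<lambda>x. diag e d x - \<mu> *\<^sub>C x)"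
            by (rule bounded_clinear_minus[OF bounded_clinear_diag[OF d] bounded_clinear_const_scaleC])
          show "bounded_clinear (\<lambda>x. U (S (U' x)))"
            by (rule bounded_clinear_compose[OF linU bounded_clinear_compose[OF S linU']])
          show "(\<lambda>x. U (S (U' x))) \<circ> (\<lambda>x. diag e d x - \<mu> *\<^sub>C x) = id"
            unfolding D using fun_cong[OF S1] by (simp add: fun_eq_iff invU)
          show "(\<lambda>x. diag e d x - \<mu> *\<^sub>C x) \<circ> (\<lambda>x. U (S (U' x))) = id"
            unfolding D using fun_cong[OF S2] by (simp add: fun_eq_iff invU)
        qed
        then show False using \<mu> by (simp add: spectrum_def)
      qed
    qed
    moreover have "trace_class e (cond_exp e (\<lambda>x. N x - diag e d x))"
      using dev(2)
      by (subst trace_class_cond_exp_iff[OF bounded_clinear_minus[OF linN bounded_clinear_diag[OF d]]])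
        (simp add: cinner.diff_left diag_coeff[OF d] cinner_basis)
    ultimately show "\<exists>N'. diagonal_op e N' \<and> spectrum N' \<subseteq> spectrum N \<and>
        trace_class e (cond_exp e (\<lambda>x. N x - N' x))"
      using diagonal_op_diag[OF d] by blast
  next

    \<comment> \<open>Trace formula for an arbitrary admissible diagonal operator\<close>
    fix N' assume N': "diagonal_op e N' \<and> spectrum N' \<subseteq> spectrum N \<and>
      trace_class e (cond_exp e (\<lambda>x. N x - N' x))"
    then obtain d' where d': "bounded (range d')" and N'_eq: "N' = diag e d'"
      using diagonal_opE by blast
    have lin: "bounded_clinear (\<lambda>x. N x - N' x)"
      unfolding N'_eq by (rule bounded_clinear_minus[OF linN bounded_clinear_diag[OF d']])
    \<comment> \<open>The first difference sums to 0; the whole trace comes from the second, which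
      has finite support.\<close>
    have entry: "cinner (N (e n) - N' (e n)) (e n) = (cinner (N (e n)) (e n) - d n) + (d n - d' n)" for n
      by (simp add: N'_eq cinner.diff_left diag_coeff[OF d'] cinner_basis)
    have fin': "finite (spectrum N')" using N' assms(3) finite_subset by blast
    \<comment> \<open>As \<open>N'\<close> is already diagonal, the facts on transported diagonal
      operators apply with the identity as the unitary.\<close>
    have d'N': "range d' \<subseteq> spectrum N'"
      by (rule unitary_diag_entries_in_spectrum[OF bounded_clinear_id refl refl refl d']) (simp add: N'_eq)
    have Q: "spectral_proj N' \<mu> = diag e (indicator (d' -` {\<mu>}))" for \<mu>
      by (rule spectral_proj_unitary_diag[OF bounded_clinear_id refl refl refl d' _ fin', simplified])
        (simp add: N'_eq)
    have d'N: "range d' \<subseteq> spectrum N" using d'N' N' by blast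
    have "summable (\<lambda>n. cmod (cinner (N (e n) - N' (e n)) (e n)))"
      using N' trace_class_cond_exp_iff[OF lin] by simp
    then have "summable (\<lambda>n. cinner (N (e n) - N' (e n)) (e n) - (cinner (N (e n)) (e n) - d n))"
      by (rule summable_diff[OF summable_norm_cancel sums_summable[OF dev(3)]])
    then have "summable (\<lambda>n. d n - d' n)" by (simp add: entry)
    then have F: "finite {n. d n \<noteq> d' n}" by (rule finite_disagreement[OF assms(3) dN d'N])
    have fin: "finite (d -` {\<mu>} - d' -` {\<mu>})" "finite (d' -` {\<mu>} - d -` {\<mu>})" for \<mu>
      by (auto intro: finite_subset[OF _ F])
    define c where "c \<mu> = int (card (d -` {\<mu>} - d' -` {\<mu>})) - int (card (d' -` {\<mu>} - d -` {\<mu>}))" for \<mu>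
    have codim: "essential_codim (spectral_proj N \<mu>) (spectral_proj N' \<mu>) = c \<mu>" for \<mu>
      unfolding P Q c_def
      by (rule essential_codim_unitary_diag[OF K dev(1) adjK U_def U'_def invU fin])
    note sd = sums_disagreement[OF assms(3) dN d'N F, folded c_def]
    have "(\<lambda>n. cinner (N (e n) - N' (e n)) (e n)) sums (0 + (\<Sum>\<mu>\<in>spectrum N. of_int (c \<mu>) * \<mu>))"
      unfolding entry by (rule sums_add[OF dev(3) sd(1)])
    then have tr: "trace_op e (cond_exp e (\<lambda>x. N x - N' x)) = (\<Sum>\<mu>\<in>spectrum N. of_int (c \<mu>) * \<mu>)"
      by (simp add: trace_op_cond_exp[OF lin] sums_iff)
    then show "trace_op e (cond_exp e (\<lambda>x. N x - N' x)) =
        (\<Sum>\<mu>\<in>spectrum N. of_int (essential_codim (spectral_proj N \<mu>) (spectral_proj N' \<mu>)) * \<mu>)"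
      by (simp add: codim)
    show "trace_op e (cond_exp e (\<lambda>x. N x - N' x)) \<in> K_module (spectrum N)"
      unfolding K_module_def tr using sd(2) by blast

    \<comment> \<open>Hilbert-Schmidt differences of spectral projections\<close>
    show "hilbert_schmidt e (\<lambda>x. spectral_proj N \<mu> x - spectral_proj N' \<mu> x)" for \<mu>
    proof -
      define R where "R = diag e (indicator (d -` {\<mu>}))"
      have linR: "bounded_clinear R" unfolding R_def by (rule bounded_clinear_diag) simp
      define \<delta> :: "nat \<Rightarrow> complex" where "\<delta> n = indicator (d -` {\<mu>}) n - indicator (d' -` {\<mu>}) n" for n
      have "{n. \<delta> n \<noteq> 0} \<subseteq> {n. d n \<noteq> d' n}" by (auto simp: \<delta>_def indicator_def)
      then have fin\<delta>: "finite {n. \<delta> n \<noteq> 0}" using F by (rule finite_subset)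
      have "bounded (range \<delta>)"
        by (auto intro!: boundedI[of _ 1] simp: \<delta>_def indicator_def)
      then have \<delta>: "diag e \<delta> x = R x - diag e (indicator (d' -` {\<mu>})) x" for x
        by (intro coeff_ext) (simp add: R_def diag_coeff[OF \<open>bounded (range \<delta>)\<close>] cinner.diff_left
            diag_coeff[OF bounded_range_indicator] \<delta>_def left_diff_distrib)
      \<comment> \<open>Expanding \<open>(1 + K') R (1 + K)\<close> leaves three terms with a
        Hilbert-Schmidt factor, and \<open>R\<close> minus the projection of \<open>N'\<close>. That
        last difference is \<open>diag e \<delta>\<close>, of finite rank because \<open>d\<close>
        and \<open>d'\<close> differ at finitely many indices.\<close>
      have "spectral_proj N \<mu> x - spectral_proj N' \<mu> x =
          (R (K x) + K' (R x)) + (K' (R (K x)) + diag e \<delta> x)" for x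
        unfolding P Q \<delta> R_def[symmetric] U_def U'_def
        by (simp add: bounded_clinear_add[OF linR]
            bounded_clinear_add[OF hilbert_schmidt_bounded_clinear[OF dev(1)]])
      then have "(\<lambda>x. spectral_proj N \<mu> x - spectral_proj N' \<mu> x) =
          (\<lambda>x. (R (K x) + K' (R x)) + (K' (R (K x)) + diag e \<delta> x))" by blast
      moreover have "hilbert_schmidt e (\<lambda>x. K' (R x))"
        unfolding R_def by (rule hilbert_schmidt_compose_diag[OF dev(1) bounded_range_indicator])
      moreover have RK: "hilbert_schmidt e (\<lambda>x. R (K x))" by (rule hilbert_schmidt_compose[OF linR K])
      moreover have "hilbert_schmidt e (\<lambda>x. K' (R (K x)))"
        by (rule hilbert_schmidt_compose[OF hilbert_schmidt_bounded_clinear[OF dev(1)] RK])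
      ultimately show ?thesis
        by (simp add: hilbert_schmidt_plus hilbert_schmidt_diag[OF fin\<delta>])
    qed
  qed
qed

end
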